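(* Let $q$ satisfy condition $\mathbf{A}$ for $x\ge 0$, and assume $0$ is not an eigenvalue of $L_U$. Then there is a constant $K>0$ such that for all $f\in L_2(\mathbb{R}_+)$, with $y=L_U^{-1}f$, $$\int_0^\infty\rho(x)|y(x)|^2dx\le K\int_0^\infty\frac{|f(x)|^2}{|q(x)|}dx,\qquad \int_0^\infty\frac{\rho(x)}{|q(x)|}|y'(x)|^2dx\le K\int_0^\infty\frac{|f(x)|^2}{|q(x)|}dx;$$ i.e. $L_U^{-1}$ extends to a bounded operator from $L_2(\mathbb{R}_+,1/|q|)$ to $L_2(\mathbb{R}_+,\rho)$, and $f\mapsto \frac{d}{dx}(L_U^{-1}f)$ extends to a bounded operator from $L_2(\mathbb{R}_+,1/|q|)$ to $L_2(\mathbb{R}_+,\rho/|q|)$.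
   Context: $\mathbb{R}_+=[0,+\infty)$. For a positive weight $w$, $L_2(\mathbb{R}_+,w)=\{f:\int_0^\infty w|f|^2dx<\infty\}$. Let $q\in L_{1,loc}(\mathbb{R}_+)$ be complex-valued, $l(y)=-y''+q(x)y$, $D=\{y\in L_2(\mathbb{R}_+): y,y'\in AC_{loc}(\mathbb{R}_+),\ l(y)\in L_2(\mathbb{R}_+)\}$; for $\alpha_0,\alpha_1\in\mathbb{C}$, $|\alpha_0|+|\alpha_1|\ne0$, $U(y)=\alpha_0y(0)+\alpha_1y'(0)$, $D_U=\{y\in D:U(y)=0\}$, $L_Uy=l(y)$ on $D_U$. $\Pi_\kappa=\{z\ne0:\arg z\in(-\pi+\kappa,\pi-\kappa)\}$. $q$ satisfies condition $\mathbf{A}$ for $x\ge 0$ if $q$ is locally absolutely continuous on $[0,\infty)$, $q([0,\infty))\subset\Pi_\kappa$ for some $\kappa\ge0$, and there is $C>0$ with $\operatorname{Re}p(x)\ge C+\frac12|p'(x)/p(x)|$ for a.e. $x\ge0$, where $p=\sqrt q$ with $\operatorname{Re}p>0$. Set $\rho(x)=\operatorname{Re}p(x)-\frac12|p'(x)/p(x)|$. *)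

theory Defs
  imports "HOL-Analysis.Analysis"
begin

definition abs_cont_on :: "real \<Rightarrow> real \<Rightarrow> (real \<Rightarrow> complex) \<Rightarrow> bool" where
  "abs_cont_on a b g \<longleftrightarrow>
     (\<forall>\<epsilon>>0. \<exists>\<delta>>0. \<forall>(n::nat) (s::nat \<Rightarrow> real) (t::nat \<Rightarrow> real).
        (\<forall>i<n. a \<le> s i \<and> s i \<le> t i \<and> t i \<le> b) \<and>
        (\<forall>i<n. \<forall>j<n. i \<noteq> j \<longrightarrow> t i \<le> s j \<or> t j \<le> s i) \<and>
        (\<Sum>i<n. t i - s i) < \<delta>
        \<longrightarrow> (\<Sum>i<n. cmod (g (t i) - g (s i))) < \<epsilon>)"

definition loc_abs_cont :: "(real \<Rightarrow> complex) \<Rightarrow> bool" where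
  "loc_abs_cont g \<longleftrightarrow> (\<forall>b\<ge>0. abs_cont_on 0 b g)"

definition L2_plus :: "(real \<Rightarrow> complex) \<Rightarrow> bool" where
  "L2_plus f \<longleftrightarrow> set_borel_measurable lborel {0..} f \<and>
     (\<integral>\<^sup>+x\<in>{0..}. ennreal ((cmod (f x))\<^sup>2) \<partial>lborel) < \<infinity>"

definition sector :: "real \<Rightarrow> complex set" where
  "sector \<kappa> = {z. z \<noteq> 0 \<and> - pi + \<kappa> < Arg z \<and> Arg z < pi - \<kappa>}"

text \<open>p = sqrt q with Re p > 0 (principal branch; q takes values off (-\<infinity>,0]).\<close>
definition psq :: "(real \<Rightarrow> complex) \<Rightarrow> real \<Rightarrow> complex" where
  "psq q x = csqrt (q x)"

definition condition_A :: "(real \<Rightarrow> complex) \<Rightarrow> (real \<Rightarrow> complex) \<Rightarrow> bool" where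
  "condition_A q dp \<longleftrightarrow>
     loc_abs_cont q \<and>
     (\<exists>\<kappa>\<ge>0. \<forall>x\<ge>0. q x \<in> sector \<kappa>) \<and>
     (AE x in lborel. x \<ge> 0 \<longrightarrow> (psq q has_vector_derivative dp x) (at x)) \<and>
     (\<exists>C>0. AE x in lborel. x \<ge> 0 \<longrightarrow>
        Re (psq q x) \<ge> C + cmod (dp x / psq q x) / 2)"

definition rho :: "(real \<Rightarrow> complex) \<Rightarrow> (real \<Rightarrow> complex) \<Rightarrow> real \<Rightarrow> real" where
  "rho q dp x = Re (psq q x) - cmod (dp x / psq q x) / 2"

text \<open>solves_LU q a0 a1 y y1 f: y \<in> D_U with quasi-derivative y1 = y' and l(y) = -y'' + q y = f,
  where f \<in> L_2(R_+).  y, y' are locally absolutely continuous, y' is the derivative of y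
  and f = q y - y'' a.e. on [0,\<infinity>); boundary condition a0 y(0) + a1 y'(0) = 0.\<close>
definition solves_LU ::
  "(real \<Rightarrow> complex) \<Rightarrow> complex \<Rightarrow> complex \<Rightarrow> (real \<Rightarrow> complex) \<Rightarrow> (real \<Rightarrow> complex)
     \<Rightarrow> (real \<Rightarrow> complex) \<Rightarrow> bool" where
  "solves_LU q a0 a1 y y1 f \<longleftrightarrow>
     L2_plus y \<and> L2_plus f \<and> loc_abs_cont y \<and> loc_abs_cont y1 \<and>
     (AE x in lborel. x \<ge> 0 \<longrightarrow> (y has_vector_derivative y1 x) (at x)) \<and>
     (AE x in lborel. x \<ge> 0 \<longrightarrow> (y1 has_vector_derivative (q x * y x - f x)) (at x)) \<and>
     a0 * y 0 + a1 * y1 0 = 0"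

end

theory Submission
  imports Defs
begin

text \<open>
  For a solution of \<open>- y'' + q y = f\<close> put \<open>flux = Re (y' * cnj y / p)\<close> with \<open>p\<^sup>2 = q\<close>. Since
  \<open>Re (1 / p) = Re p / |p|\<^sup>2\<close>, differentiation gives
  \<open>flux' \<ge> rho (|y|\<^sup>2 + |y' / p|\<^sup>2) - |f / p| |y| \<ge> rho / 2 (|y|\<^sup>2 + |y' / p|\<^sup>2) - |f|\<^sup>2 / (2 C |q|)\<close>,
  so that both weighted norms over \<open>[a, b]\<close> are bounded by \<open>flux b - flux a\<close> and the weighted norm of \<open>f\<close>.
  If \<open>y\<close> is square-integrable, the flux cannot stay above a positive constant, and only the
  boundary term at \<open>0\<close> is left. It is estimated by splitting off a multiple of a square-integrable
  homogeneous solution, which violates the boundary condition because \<open>0\<close> is not an eigenvalue.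
  Square-integrable solutions are limits of solutions vanishing at a far endpoint, for which the
  same inequality gives uniform bounds.
\<close>

section \<open>Absolutely continuous functions\<close>

text \<open>Dividing \<open>y1 * cnj y\<close> by \<open>p\<close> puts \<open>y\<close> and
  \<open>y1 / p\<close> on one scale: after differentiation both squares carry the factor
  \<open>Re p\<close>, while the term from the derivative of \<open>1 / p\<close> is at most
  \<open>|p'/p| |y| |y'/p|\<close>, that is, half of \<open>|p'/p|\<close> times the sum of the
  squares. This loss is exactly the difference between \<open>Re p\<close> and \<open>rho\<close>.

  The obstacle at infinity: only \<open>y\<close>, and not \<open>y1 / p\<close>, is known to be
  square-integrable, \<open>p\<close> may be unbounded, and no limit of the flux is available
  beforehand. Hence a nondecreasing quantity, the flux plus the accumulated source, is compared with
  the total source through a Riccati-type inequality for a reciprocal.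

  A second obstacle is \<open>dp\<close>: it is prescribed only almost everywhere and not assumed
  Borel measurable. The estimates of integrals containing \<open>rho\<close> therefore rest on
  monotonicity of the nonnegative integral, and their upper bounds come from integrating an a.e.
  derivative of an absolutely continuous function.\<close>

lemma abs_cont_onD:
  assumes "abs_cont_on a b g" "\<epsilon> > 0"
  shows "\<exists>\<delta>>0. \<forall>(I::'i set) s t. finite I \<longrightarrow> (\<forall>i\<in>I. a \<le> s i \<and> s i \<le> t i \<and> t i \<le> b) \<longrightarrow>
       (\<forall>i\<in>I. \<forall>j\<in>I. i \<noteq> j \<longrightarrow> t i \<le> s j \<or> t j \<le> s i) \<longrightarrow>
       (\<Sum>i\<in>I. t i - s i) < \<delta> \<longrightarrow> (\<Sum>i\<in>I. cmod (g (t i) - g (s i))) < \<epsilon>"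
proof -
  from assms obtain \<delta> where \<delta>: "\<delta> > 0" "\<And>(n::nat) (s::nat \<Rightarrow> real) (t::nat \<Rightarrow> real).
        (\<forall>i<n. a \<le> s i \<and> s i \<le> t i \<and> t i \<le> b) \<and>
        (\<forall>i<n. \<forall>j<n. i \<noteq> j \<longrightarrow> t i \<le> s j \<or> t j \<le> s i) \<and>
        (\<Sum>i<n. t i - s i) < \<delta>
        \<longrightarrow> (\<Sum>i<n. cmod (g (t i) - g (s i))) < \<epsilon>"
    unfolding abs_cont_on_def by blast
  show ?thesis
  proof (intro exI conjI allI impI)
    show "\<delta> > 0" by fact
  next
    fix I :: "'i set" and s t :: "'i \<Rightarrow> real"
    assume I: "finite I" and st: "\<forall>i\<in>I. a \<le> s i \<and> s i \<le> t i \<and> t i \<le> b"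
      and d: "\<forall>i\<in>I. \<forall>j\<in>I. i \<noteq> j \<longrightarrow> t i \<le> s j \<or> t j \<le> s i"
      and len: "(\<Sum>i\<in>I. t i - s i) < \<delta>"
    obtain h where h: "bij_betw h {..<card I} I"
      using ex_bij_betw_nat_finite[OF I] by (auto simp: atLeast0LessThan)
    have hI: "h i \<in> I" if "i < card I" for i
      using h that by (auto simp: bij_betw_def)
    have inj: "h i \<noteq> h j" if "i < card I" "j < card I" "i \<noteq> j" for i j
      using h that by (auto simp: bij_betw_def inj_on_def)
    have re: "(\<Sum>i\<in>I. F i) = (\<Sum>i<card I. F (h i))" for F :: "'i \<Rightarrow> real"
      using sum.reindex_bij_betw[OF h, of F] by simp
    have "(\<Sum>i<card I. cmod (g (t (h i)) - g (s (h i)))) < \<epsilon>"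
    proof (rule \<delta>(2)[rule_format], intro conjI allI impI)
      show "t (h i) \<le> s (h j) \<or> t (h j) \<le> s (h i)" if "i < card I" "j < card I" "i \<noteq> j" for i j
        using d hI inj that by blast
      show "(\<Sum>i<card I. t (h i) - s (h i)) < \<delta>"
        using len re[of "\<lambda>i. t i - s i"] by simp
    qed (use st hI in auto)
    then show "(\<Sum>i\<in>I. cmod (g (t i) - g (s i))) < \<epsilon>"
      using re[of "\<lambda>i. cmod (g (t i) - g (s i))"] by simp
  qed
qed

lemma abs_cont_on_subset: "abs_cont_on a b g \<Longrightarrow> a \<le> c \<Longrightarrow> d \<le> b \<Longrightarrow> abs_cont_on c d g"
  unfolding abs_cont_on_def
  by (erule all_forward, erule imp_forward, assumption, erule ex_forward, erule conj_forward,
      assumption, (erule all_forward)+, erule imp_forward) auto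

lemma abs_cont_on_continuous:
  assumes "abs_cont_on a b g" shows "continuous_on {a..b} g"
  unfolding continuous_on_iff
proof (intro ballI allI impI)
  fix x e :: real assume x: "x \<in> {a..b}" and e: "e > 0"
  from abs_cont_onD[OF assms e, where 'i = unit] obtain \<delta> where \<delta>: "\<delta> > 0"
    "\<And>(I::unit set) s t. finite I \<Longrightarrow> \<forall>i\<in>I. a \<le> s i \<and> s i \<le> t i \<and> t i \<le> b \<Longrightarrow>
       \<forall>i\<in>I. \<forall>j\<in>I. i \<noteq> j \<longrightarrow> t i \<le> s j \<or> t j \<le> s i \<Longrightarrow>
       (\<Sum>i\<in>I. t i - s i) < \<delta> \<Longrightarrow> (\<Sum>i\<in>I. cmod (g (t i) - g (s i))) < e"
    by blast
  have "dist (g y) (g x) < e" if y: "y \<in> {a..b}" "dist y x < \<delta>" for y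
  proof (cases "x \<le> y")
    case True then show ?thesis
      using \<delta>(2)[of "UNIV" "\<lambda>_. x" "\<lambda>_. y"] x y by (auto simp: dist_norm)
  next
    case False then show ?thesis
      using \<delta>(2)[of "UNIV" "\<lambda>_. y" "\<lambda>_. x"] x y by (auto simp: dist_norm norm_minus_commute)
  qed
  then show "\<exists>d>0. \<forall>x'\<in>{a..b}. dist x' x < d \<longrightarrow> dist (g x') (g x) < e"
    using \<delta>(1) by blast
qed

lemma abs_cont_on_bounded:
  assumes "abs_cont_on a b h"
  obtains M where "M > 0" "\<And>x. x \<in> {a..b} \<Longrightarrow> cmod (h x) \<le> M"
proof -
  have "bounded (h ` {a..b})"
    using assms abs_cont_on_continuous compact_continuous_image compact_imp_bounded by blast
  then show thesis using that unfolding bounded_pos by (metis imageI)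
qed

text \<open>One comparison of increments serves all closure properties below: linear images, sums,
  products, reciprocals and the square root of \<open>q\<close>. Where a single function controls
  \<open>h\<close>, it is entered twice.\<close>

lemma abs_cont_on_combine:
  assumes g1: "abs_cont_on a b g1" and g2: "abs_cont_on a b g2" and K: "0 \<le> K"
    and le: "\<And>s t. a \<le> s \<Longrightarrow> s \<le> t \<Longrightarrow> t \<le> b \<Longrightarrow>
       cmod (h t - h s) \<le> K * (cmod (g1 t - g1 s) + cmod (g2 t - g2 s))"
  shows "abs_cont_on a b h"
  unfolding abs_cont_on_def
proof (intro allI impI)
  fix \<epsilon> :: real assume "\<epsilon> > 0"
  \<comment> \<open>Each of the two sums is kept below \<open>\<epsilon>'\<close>;
    \<open>K + 1\<close> in place of \<open>K\<close> covers \<open>K = 0\<close> and makes the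
    final inequality strict.\<close>
  define \<epsilon>' where "\<epsilon>' = \<epsilon> / (2 * (K + 1))"
  have e': "\<epsilon>' > 0" using \<open>\<epsilon> > 0\<close> K by (simp add: \<epsilon>'_def)
  obtain d1 where d1: "d1 > 0" "\<And>(n::nat) (s::nat \<Rightarrow> real) (t::nat \<Rightarrow> real).
        (\<forall>i<n. a \<le> s i \<and> s i \<le> t i \<and> t i \<le> b) \<and>
        (\<forall>i<n. \<forall>j<n. i \<noteq> j \<longrightarrow> t i \<le> s j \<or> t j \<le> s i) \<and>
        (\<Sum>i<n. t i - s i) < d1
        \<longrightarrow> (\<Sum>i<n. cmod (g1 (t i) - g1 (s i))) < \<epsilon>'"
    using g1 e' unfolding abs_cont_on_def by blast
  obtain d2 where d2: "d2 > 0" "\<And>(n::nat) (s::nat \<Rightarrow> real) (t::nat \<Rightarrow> real).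
        (\<forall>i<n. a \<le> s i \<and> s i \<le> t i \<and> t i \<le> b) \<and>
        (\<forall>i<n. \<forall>j<n. i \<noteq> j \<longrightarrow> t i \<le> s j \<or> t j \<le> s i) \<and>
        (\<Sum>i<n. t i - s i) < d2
        \<longrightarrow> (\<Sum>i<n. cmod (g2 (t i) - g2 (s i))) < \<epsilon>'"
    using g2 e' unfolding abs_cont_on_def by blast
  show "\<exists>\<delta>>0. \<forall>(n::nat) (s::nat \<Rightarrow> real) (t::nat \<Rightarrow> real).
        (\<forall>i<n. a \<le> s i \<and> s i \<le> t i \<and> t i \<le> b) \<and>
        (\<forall>i<n. \<forall>j<n. i \<noteq> j \<longrightarrow> t i \<le> s j \<or> t j \<le> s i) \<and>
        (\<Sum>i<n. t i - s i) < \<delta>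
        \<longrightarrow> (\<Sum>i<n. cmod (h (t i) - h (s i))) < \<epsilon>"
  proof (intro exI[of _ "min d1 d2"] conjI allI impI)
    fix n and s t :: "nat \<Rightarrow> real"
    assume A: "(\<forall>i<n. a \<le> s i \<and> s i \<le> t i \<and> t i \<le> b) \<and>
        (\<forall>i<n. \<forall>j<n. i \<noteq> j \<longrightarrow> t i \<le> s j \<or> t j \<le> s i) \<and>
        (\<Sum>i<n. t i - s i) < min d1 d2"
    have 1: "(\<Sum>i<n. cmod (g1 (t i) - g1 (s i))) < \<epsilon>'" using d1(2)[of n s t] A by simp
    have 2: "(\<Sum>i<n. cmod (g2 (t i) - g2 (s i))) < \<epsilon>'" using d2(2)[of n s t] A by simp
    have "(\<Sum>i<n. cmod (h (t i) - h (s i))) \<le>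
        (\<Sum>i<n. K * (cmod (g1 (t i) - g1 (s i)) + cmod (g2 (t i) - g2 (s i))))"
      using A le by (intro sum_mono) auto
    also have "\<dots> = K * ((\<Sum>i<n. cmod (g1 (t i) - g1 (s i))) + (\<Sum>i<n. cmod (g2 (t i) - g2 (s i))))"
      by (simp add: sum.distrib flip: sum_distrib_left)
    also have "\<dots> \<le> K * (\<epsilon>' + \<epsilon>')"
      using 1 2 K by (intro mult_left_mono) auto
    also have "\<dots> < (K + 1) * (\<epsilon>' + \<epsilon>')"
      using e' by simp
    also have "\<dots> = \<epsilon>"
    proof -
      have "2 * (K + 1) \<noteq> 0" using K by simp
      then have "2 * (K + 1) * \<epsilon>' = \<epsilon>" unfolding \<epsilon>'_def by simp
      then show ?thesis by (simp add: algebra_simps)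
    qed
    finally show "(\<Sum>i<n. cmod (h (t i) - h (s i))) < \<epsilon>" .
  qed (use d1 d2 in auto)
qed

text \<open>The increments are compared with those of the embedding \<open>of_real\<close>, for
  which \<open>\<delta> = \<epsilon>\<close> works.\<close>

lemma abs_cont_on_lipschitz:
  assumes K: "0 \<le> K"
    and le: "\<And>s t. a \<le> s \<Longrightarrow> s \<le> t \<Longrightarrow> t \<le> b \<Longrightarrow> cmod (h t - h s) \<le> K * (t - s)"
  shows "abs_cont_on a b h"
proof (rule abs_cont_on_combine[where K = K and ?g1.0 = of_real and ?g2.0 = of_real])
  show "abs_cont_on a b of_real"
    unfolding abs_cont_on_def
  proof (intro allI impI)
    fix \<epsilon> :: real assume e: "\<epsilon> > 0"
    have "(\<Sum>i<n. cmod (of_real (t i) - of_real (s i))) < \<epsilon>"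
      if "\<forall>i<n. a \<le> s i \<and> s i \<le> t i \<and> t i \<le> b" "(\<Sum>i<n. t i - s i) < \<epsilon>" for n and s t :: "nat \<Rightarrow> real"
    proof -
      have "(\<Sum>i<n. cmod (of_real (t i) - of_real (s i))) = (\<Sum>i<n. t i - s i)"
        using that(1) by (intro sum.cong) (auto simp flip: of_real_diff)
      then show ?thesis using that by simp
    qed
    then show "\<exists>\<delta>>0. \<forall>(n::nat) (s::nat \<Rightarrow> real) (t::nat \<Rightarrow> real).
        (\<forall>i<n. a \<le> s i \<and> s i \<le> t i \<and> t i \<le> b) \<and>
        (\<forall>i<n. \<forall>j<n. i \<noteq> j \<longrightarrow> t i \<le> s j \<or> t j \<le> s i) \<and>
        (\<Sum>i<n. t i - s i) < \<delta>
        \<longrightarrow> (\<Sum>i<n. cmod (of_real (t i) - of_real (s i))) < \<epsilon>"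
      using e by blast
  qed
  show "abs_cont_on a b of_real" by fact
  show "cmod (h t - h s) \<le> K * (cmod (of_real t - of_real s) + cmod (of_real t - of_real s))"
    if "a \<le> s" "s \<le> t" "t \<le> b" for s t
  proof -
    have "cmod (of_real t - of_real s) = t - s"
      using that by (simp flip: of_real_diff)
    moreover have "K * (t - s) \<le> K * ((t - s) + (t - s))" using K that by (intro mult_left_mono) auto
    ultimately show ?thesis using le[OF that] by simp
  qed
qed (rule K)

lemma abs_cont_on_linear_image:
  assumes "bounded_linear L" "abs_cont_on a b h"
  shows "abs_cont_on a b (\<lambda>x. L (h x))"
proof -
  interpret bounded_linear L by fact
  obtain K where K: "0 \<le> K" "\<And>x. cmod (L x) \<le> cmod x * K"
    using nonneg_bounded by blast
  show ?thesis
  proof (rule abs_cont_on_combine[OF assms(2) assms(2) K(1)])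
    fix s t
    have "cmod (L (h t) - L (h s)) \<le> cmod (h t - h s) * K"
      using K(2)[of "h t - h s"] by (simp add: diff)
    also have "\<dots> \<le> K * (cmod (h t - h s) + cmod (h t - h s))"
      using K(1) by (simp add: algebra_simps)
    finally show "cmod (L (h t) - L (h s)) \<le> K * (cmod (h t - h s) + cmod (h t - h s))" .
  qed
qed

section \<open>Null sets and the fundamental theorem of calculus for absolutely continuous
  functions\<close>

lemma negligible_of_AE:
  assumes "AE x in lborel. P x"
  obtains N where "negligible N" "\<And>x. x \<notin> N \<Longrightarrow> P x"
proof -
  obtain N where N: "N \<in> null_sets lborel" "{x. \<not> P x} \<subseteq> N"
    using assms unfolding eventually_ae_filter by auto
  show thesis
    using that[of N] N null_sets_completionI[OF N(1)] by (auto simp: negligible_iff_null_sets)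
qed

text \<open>A negligible set is null for the completed measure and need not be Borel, so the a.e.
  statement is obtained for \<open>lebesgue\<close> first and then transferred.\<close>

lemma AE_of_negligible:
  assumes "negligible N" "\<And>x. x \<notin> N \<Longrightarrow> P x"
  shows "AE x in lborel. P x"
proof -
  have "AE x in lebesgue. P x"
    using assms unfolding negligible_iff_null_sets eventually_ae_filter by auto
  then show ?thesis by (simp add: AE_completion_iff)
qed

text \<open>At tags in the exceptional set the gauge stays inside an open set of small measure, where
  absolute continuity controls the increments of \<open>g\<close>; elsewhere it is the straddle gauge.
  Degenerate cells are discarded first, as they need not be ordered with respect to the others.\<close>
theorem abs_cont_on_has_integral:
  assumes ab: "a \<le> b" and g: "abs_cont_on a b g" and N: "negligible N"
    and der: "\<And>x. x \<in> {a..b} - N \<Longrightarrow> (g has_vector_derivative k x) (at x within {a..b})"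
  shows "(k has_integral (g b - g a)) {a..b}"
proof -
  \<comment> \<open>With value \<open>0\<close> on \<open>N\<close>, a tag in \<open>N\<close>
    contributes nothing to the Riemann sum, and only the increment of \<open>g\<close> over its cell
    has to be controlled.\<close>
  define k' where "k' x = (if x \<in> N then 0 else k x)" for x
  have "(k' has_integral (g b - g a)) {a..b}"
    unfolding has_integral_real
  proof (intro allI impI)
    fix e :: real assume e: "e > 0"
    \<comment> \<open>Half of \<open>e\<close> is spent on the tags with a derivative, in proportion
      to the cell length; the \<open>+ 1\<close> covers \<open>a = b\<close>. The other half goes to
      the tags in \<open>N\<close>.\<close>
    define e1 where "e1 = e / 2 / (b - a + 1)"
    have e1: "e1 > 0" using e ab by (simp add: e1_def)
    \<comment> \<open>The intervals will be cells of a tagged division, so they are indexed by pairs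
      of a tag and a cell.\<close>
    from abs_cont_onD[OF g half_gt_zero[OF e], where 'i = "real \<times> real set"]
    obtain \<delta> where \<delta>: "\<delta> > 0"
      "\<And>(I::(real \<times> real set) set) s t. finite I \<Longrightarrow>
         \<forall>i\<in>I. a \<le> s i \<and> s i \<le> t i \<and> t i \<le> b \<Longrightarrow>
         \<forall>i\<in>I. \<forall>j\<in>I. i \<noteq> j \<longrightarrow> t i \<le> s j \<or> t j \<le> s i \<Longrightarrow>
         (\<Sum>i\<in>I. t i - s i) < \<delta> \<Longrightarrow> (\<Sum>i\<in>I. cmod (g (t i) - g (s i))) < e / 2"
      by blast
    have Nnull: "N \<in> null_sets lebesgue" using N by (simp add: negligible_iff_null_sets)
    then have "N \<in> sets lebesgue" by auto
    then obtain T where T: "open T" "N \<subseteq> T" "emeasure lebesgue (T - N) < ennreal \<delta>"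
      using sets_lebesgue_outer_open[of N \<delta>] \<delta>(1) by (metis ennreal_less_zero_iff)
    have Tm: "emeasure lebesgue T < ennreal \<delta>"
    proof -
      have "emeasure lebesgue (T - N) = emeasure lebesgue T"
        using Nnull T(1) by (intro emeasure_Diff_null_set) auto
      then show ?thesis using T(3) by simp
    qed
    have "\<exists>d>0. (x \<in> N \<longrightarrow> ball x d \<subseteq> T) \<and> (x \<in> {a..b} - N \<longrightarrow> (\<forall>y\<in>{a..b}. norm (y - x) < d \<longrightarrow>
        norm (g y - g x - (y - x) *\<^sub>R k x) \<le> e1 * norm (y - x)))" for x
    proof (cases "x \<in> N")
      case True
      then show ?thesis using T(1,2) by (meson Diff_iff openE subsetD)
    next
      case False
      then show ?thesis
        using der[of x] e1 unfolding has_vector_derivative_def has_derivative_within_alt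
        by (cases "x \<in> {a..b}") (auto intro: exI[of _ 1])
    qed
    then obtain d where d: "\<And>x. d x > 0" "\<And>x. x \<in> N \<Longrightarrow> ball x (d x) \<subseteq> T"
      "\<And>x y. x \<in> {a..b} - N \<Longrightarrow> y \<in> {a..b} \<Longrightarrow> norm (y - x) < d x \<Longrightarrow>
        norm (g y - g x - (y - x) *\<^sub>R k x) \<le> e1 * norm (y - x)"
      by metis
    show "\<exists>\<gamma>. gauge \<gamma> \<and> (\<forall>\<D>. \<D> tagged_division_of {a..b} \<and> \<gamma> fine \<D> \<longrightarrow>
        norm ((\<Sum>(x, K)\<in>\<D>. measure lborel K *\<^sub>R k' x) - (g b - g a)) < e)"
    proof (intro exI[of _ "\<lambda>x. ball x (d x)"] conjI allI impI, goal_cases)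
      case 1 then show ?case using d(1) gauge_ball_dependent by blast
    next
      case (2 p)
      then have p: "p tagged_division_of {a..b}" and fine: "(\<lambda>x. ball x (d x)) fine p" by auto
      have finp: "finite p" using p by (rule tagged_division_of_finite)
      have pK: "\<exists>u v. K = {u..v} \<and> u \<le> v \<and> x \<in> {u..v} \<and> a \<le> u \<and> v \<le> b \<and> {u..v} \<subseteq> ball x (d x)"
        if xKp: "(x, K) \<in> p" for x K
      proof -
        obtain u v where K: "K = cbox u v" using tagged_division_ofD(4)[OF p xKp] by blast
        have xK: "x \<in> K" "K \<subseteq> {a..b}" using tagged_division_ofD(2,3)[OF p xKp] .
        have "u \<le> v" using xK K by auto
        moreover have "K \<subseteq> ball x (d x)" using fine xKp by (auto simp: fine_def)
        ultimately show ?thesis using K xK by auto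
      qed
      define P where "P = {i \<in> p. fst i \<in> N \<and> Inf (snd i) < Sup (snd i)}"
      have finP: "finite P" "P \<subseteq> p" using finp by (auto simp: P_def)
      define s t where "s i = Inf (snd i)" and "t i = Sup (snd i)" for i :: "real \<times> real set"
      have st: "snd i = {s i..t i} \<and> s i \<le> t i \<and> fst i \<in> {s i..t i} \<and> a \<le> s i \<and> t i \<le> b \<and>
          {s i..t i} \<subseteq> ball (fst i) (d (fst i))" if "i \<in> p" for i
        using pK[of "fst i" "snd i"] that by (auto simp: s_def t_def)
      have lt: "s i < t i" if "i \<in> P" for i using that by (auto simp: P_def s_def t_def)
      have ord: "t i \<le> s j \<or> t j \<le> s i" if "i \<in> P" "j \<in> P" "i \<noteq> j" for i j
      proof (rule ccontr)
        assume "\<not> ?thesis"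
        then have "max (s i) (s j) < min (t i) (t j)" using lt that by auto
        then obtain z where z: "max (s i) (s j) < z" "z < min (t i) (t j)" using dense by blast
        have "interior (snd i) \<inter> interior (snd j) = {}"
          using tagged_division_ofD(5)[OF p, of "fst i" "snd i" "fst j" "snd j"] that finP(2)
          by (auto simp: prod_eq_iff)
        moreover have "z \<in> interior (snd i) \<inter> interior (snd j)"
        proof -
          have "i \<in> p" "j \<in> p" using that finP(2) by auto
          then have "snd i = {s i..t i}" "snd j = {s j..t j}" using st by blast+
          then show ?thesis using z by (simp add: interior_atLeastAtMost_real)
        qed
        ultimately show False by blast
      qed
      have "(\<Sum>i\<in>P. t i - s i) < \<delta>"
      proof -
        have "ennreal (\<Sum>i\<in>P. t i - s i) = (\<Sum>i\<in>P. ennreal (t i - s i))"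
          using lt by (intro sum_ennreal[symmetric]) (auto simp: less_imp_le)
        also have "\<dots> = (\<Sum>i\<in>P. emeasure lebesgue {s i<..<t i})"
          using lt by (intro sum.cong) (auto simp: less_imp_le)
        also have "\<dots> = emeasure lebesgue (\<Union>i\<in>P. {s i<..<t i})"
          using ord finP by (intro sum_emeasure) (fastforce simp: disjoint_family_on_def)+
        also have "\<dots> \<le> emeasure lebesgue T"
        proof (rule emeasure_mono)
          show "(\<Union>i\<in>P. {s i<..<t i}) \<subseteq> T"
          proof (rule UN_least)
            fix i assume "i \<in> P"
            then have "i \<in> p" "fst i \<in> N" by (auto simp: P_def)
            then show "{s i<..<t i} \<subseteq> T"
              using st[of i] d(2)[of "fst i"] greaterThanLessThan_subseteq_atLeastAtMost_iff by blast
          qed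
        qed (use T(1) in auto)
        finally have "ennreal (\<Sum>i\<in>P. t i - s i) < ennreal \<delta>" using Tm by simp
        then show ?thesis
          using lt by (subst (asm) ennreal_less_iff) (auto intro!: sum_nonneg simp: less_imp_le)
      qed
      then have small: "(\<Sum>i\<in>P. cmod (g (t i) - g (s i))) < e / 2"
        using \<delta>(2)[of P s t] finP st ord by blast
      have gba: "g b - g a = (\<Sum>i\<in>p. g (t i) - g (s i))" "b - a = (\<Sum>i\<in>p. t i - s i)"
        using additive_tagged_division_1[OF ab p, of g] additive_tagged_division_1[OF ab p, of "\<lambda>x. x"]
        by (auto simp: s_def t_def split_def)
      have cell: "cmod (measure lborel (snd i) *\<^sub>R k' (fst i) - (g (t i) - g (s i)))
          \<le> e1 * (t i - s i) + (if i \<in> P then cmod (g (t i) - g (s i)) else 0)" if "i \<in> p" for i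
      proof -
        define x where "x = fst i"
        have x: "s i \<le> x" "x \<le> t i" "a \<le> s i" "t i \<le> b" "s i \<le> t i" using st[OF that] by (auto simp: x_def)
        have c: "measure lborel (snd i) = t i - s i" using st[OF that] by simp
        have e1': "0 \<le> e1 * (t i - s i)" using e1 x by simp
        show ?thesis
        proof (cases "x \<in> N")
          case True
          show ?thesis
          proof (cases "i \<in> P")
            case True
            then have "k' x = 0" using \<open>x \<in> N\<close> by (simp add: k'_def)
            then have "cmod (measure lborel (snd i) *\<^sub>R k' (fst i) - (g (t i) - g (s i))) = cmod (g (t i) - g (s i))"
              by (simp add: x_def norm_minus_commute)
            then show ?thesis using e1' True by simp
          next
            case False
            then have "s i = t i" using True that x by (auto simp: P_def s_def t_def x_def)
            then show ?thesis using c False by simp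
          qed
        next
          case False
          have xab: "x \<in> {a..b} - N" using False x by auto
          have ball: "norm (t i - x) < d x" "norm (s i - x) < d x"
          proof -
            have "t i \<in> ball x (d x)" "s i \<in> ball x (d x)"
              using st[OF that] x(5) unfolding x_def by (meson atLeastAtMost_iff order_refl subsetD)+
            then show "norm (t i - x) < d x" "norm (s i - x) < d x" by (auto simp: dist_real_def)
          qed
          have "norm (g (t i) - g x - (t i - x) *\<^sub>R k x) \<le> e1 * norm (t i - x)"
            using d(3)[OF xab _ ball(1)] x by auto
          moreover have "norm (g (s i) - g x - (s i - x) *\<^sub>R k x) \<le> e1 * norm (s i - x)"
            using d(3)[OF xab _ ball(2)] x by auto
          moreover have "norm ((t i - s i) *\<^sub>R k x - (g (t i) - g (s i))) \<le>
              norm (g (s i) - g x - (s i - x) *\<^sub>R k x) + norm (g (t i) - g x - (t i - x) *\<^sub>R k x)"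
          proof -
            have "(t i - s i) *\<^sub>R k x - (g (t i) - g (s i)) =
              (g (s i) - g x - (s i - x) *\<^sub>R k x) - (g (t i) - g x - (t i - x) *\<^sub>R k x)"
              by (simp add: algebra_simps)
            then show ?thesis using norm_triangle_ineq4 by metis
          qed
          moreover have "e1 * norm (t i - x) + e1 * norm (s i - x) = e1 * (t i - s i)"
            using x by (simp add: algebra_simps)
          ultimately have "norm ((t i - s i) *\<^sub>R k x - (g (t i) - g (s i))) \<le> e1 * (t i - s i)"
            by linarith
          moreover have "k' (fst i) = k x" using False by (simp add: k'_def x_def)
          moreover have "i \<notin> P" using False by (simp add: P_def x_def)
          ultimately show ?thesis using c by simp
        qed
      qed
      have "norm ((\<Sum>(x, K)\<in>p. measure lborel K *\<^sub>R k' x) - (g b - g a))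
          = norm (\<Sum>i\<in>p. measure lborel (snd i) *\<^sub>R k' (fst i) - (g (t i) - g (s i)))"
        by (simp add: gba(1) split_def sum_subtractf)
      also have "\<dots> \<le> (\<Sum>i\<in>p. e1 * (t i - s i) + (if i \<in> P then cmod (g (t i) - g (s i)) else 0))"
        using cell by (rule sum_norm_le)
      also have "\<dots> = e1 * (b - a) + (\<Sum>i\<in>P. cmod (g (t i) - g (s i)))"
        using finp finP(2) gba(2)
        by (simp add: sum.distrib sum_distrib_left Int_absorb1 flip: sum.inter_restrict)
      also have "\<dots> < e / 2 + e / 2"
      proof -
        have "e1 * (b - a) \<le> e1 * (b - a + 1)" using e1 by simp
        also have "\<dots> = e / 2"
        proof -
          have "b - a + 1 \<noteq> 0" using ab by simp
          then show ?thesis 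
            unfolding e1_def by (metis nonzero_eq_divide_eq)
        qed
        finally show ?thesis using small by simp
      qed
      finally show ?case by simp
    qed
  qed
  then show ?thesis
    by (rule has_integral_spike[OF N, rotated]) (auto simp: k'_def)
qed

text \<open>\<open>k\<close> is any representative of the a.e. derivative and may be changed on null
  sets. Real functions enter through \<open>of_real\<close>, since \<open>abs_cont_on\<close> speaks
  of complex values.\<close>

definition ac_deriv_on :: "real \<Rightarrow> real \<Rightarrow> (real \<Rightarrow> complex) \<Rightarrow> (real \<Rightarrow> complex) \<Rightarrow> bool" where
  "ac_deriv_on a b h k \<longleftrightarrow> abs_cont_on a b h \<and>
     (AE x in lborel. x \<in> {a..b} \<longrightarrow> (h has_vector_derivative k x) (at x))"

lemma loc_ac_deriv_iff:
  "(\<forall>b. ac_deriv_on 0 b h k) \<longleftrightarrow>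
     loc_abs_cont h \<and> (AE x in lborel. x \<ge> 0 \<longrightarrow> (h has_vector_derivative k x) (at x))"
proof
  assume *: "\<forall>b. ac_deriv_on 0 b h k"
  \<comment> \<open>Natural endpoints leave only countably many exceptional sets to unite.\<close>
  then have "AE x in lborel. \<forall>n::nat. x \<in> {0..real n} \<longrightarrow> (h has_vector_derivative k x) (at x)"
    unfolding AE_all_countable by (auto simp: ac_deriv_on_def)
  then have "AE x in lborel. x \<ge> 0 \<longrightarrow> (h has_vector_derivative k x) (at x)"
    by eventually_elim (metis atLeastAtMost_iff real_arch_simple)
  with * show "loc_abs_cont h \<and> (AE x in lborel. x \<ge> 0 \<longrightarrow> (h has_vector_derivative k x) (at x))"
    by (auto simp: loc_abs_cont_def ac_deriv_on_def)
next
  assume *: "loc_abs_cont h \<and> (AE x in lborel. x \<ge> 0 \<longrightarrow> (h has_vector_derivative k x) (at x))"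
  show "\<forall>b. ac_deriv_on 0 b h k"
    unfolding ac_deriv_on_def
  proof (intro allI conjI)
    fix b :: real
    show "abs_cont_on 0 b h"
      using * abs_cont_on_subset[of 0 "max 0 b" h 0 b] by (auto simp: loc_abs_cont_def)
    from * have "AE x in lborel. x \<ge> 0 \<longrightarrow> (h has_vector_derivative k x) (at x)" ..
    then show "AE x in lborel. x \<in> {0..b} \<longrightarrow> (h has_vector_derivative k x) (at x)"
      by eventually_elim auto
  qed
qed

lemma ac_deriv_on_has_integral:
  assumes "ac_deriv_on a b h k" "a \<le> b"
  shows "(k has_integral (h b - h a)) {a..b}"
proof -
  have "AE x in lborel. x \<in> {a..b} \<longrightarrow> (h has_vector_derivative k x) (at x)"
    using assms(1) by (simp add: ac_deriv_on_def)
  then obtain N where N: "negligible N"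
    "\<And>x. x \<notin> N \<Longrightarrow> x \<in> {a..b} \<longrightarrow> (h has_vector_derivative k x) (at x)"
    by (rule negligible_of_AE) blast
  show ?thesis
  proof (rule abs_cont_on_has_integral[OF assms(2) _ N(1)])
    show "abs_cont_on a b h" using assms(1) by (simp add: ac_deriv_on_def)
    show "(h has_vector_derivative k x) (at x within {a..b})" if "x \<in> {a..b} - N" for x
      using N(2) that by (auto intro: has_vector_derivative_at_within)
  qed
qed

section \<open>Calculus rules for absolutely continuous functions with a.e. derivatives\<close>

lemma ac_deriv_on_subset:
  "ac_deriv_on a b h k \<Longrightarrow> a \<le> c \<Longrightarrow> d \<le> b \<Longrightarrow> ac_deriv_on c d h k"
  unfolding ac_deriv_on_def by (auto intro: abs_cont_on_subset elim!: eventually_mono)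

lemma ac_deriv_on_continuous: "ac_deriv_on a b h k \<Longrightarrow> continuous_on {a..b} h"
  unfolding ac_deriv_on_def by (blast intro: abs_cont_on_continuous)

lemma ac_deriv_on_linear_image:
  assumes "bounded_linear L" "ac_deriv_on a b h k"
  shows "ac_deriv_on a b (\<lambda>x. L (h x)) (\<lambda>x. L (k x))"
  using assms abs_cont_on_linear_image[OF assms(1)] bounded_linear.has_vector_derivative[OF assms(1)]
  unfolding ac_deriv_on_def by (auto elim!: eventually_mono)

lemma ac_deriv_on_add:
  assumes "ac_deriv_on a b h k" "ac_deriv_on a b h' k'"
  shows "ac_deriv_on a b (\<lambda>x. h x + h' x) (\<lambda>x. k x + k' x)"
  unfolding ac_deriv_on_def
proof
  show "abs_cont_on a b (\<lambda>x. h x + h' x)"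
  proof (rule abs_cont_on_combine[where K = 1])
    show "abs_cont_on a b h" "abs_cont_on a b h'" using assms by (auto simp: ac_deriv_on_def)
    fix s t show "cmod (h t + h' t - (h s + h' s)) \<le> 1 * (cmod (h t - h s) + cmod (h' t - h' s))"
      by (simp add: norm_diff_triangle_ineq)
  qed simp
  show "AE x in lborel. x \<in> {a..b} \<longrightarrow> ((\<lambda>x. h x + h' x) has_vector_derivative k x + k' x) (at x)"
    using assms unfolding ac_deriv_on_def
    by (auto elim!: eventually_elim2 intro!: has_vector_derivative_add)
qed

lemma ac_deriv_on_const: "ac_deriv_on a b (\<lambda>_. c) (\<lambda>_. 0)"
  unfolding ac_deriv_on_def by (auto intro!: abs_cont_on_lipschitz[where K = 0] AE_I2)

lemma ac_deriv_on_mult: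
  assumes "ac_deriv_on a b h k" "ac_deriv_on a b h' k'"
  shows "ac_deriv_on a b (\<lambda>x. h x * h' x) (\<lambda>x. h x * k' x + k x * h' x)"
  unfolding ac_deriv_on_def
proof
  have ac: "abs_cont_on a b h" "abs_cont_on a b h'" using assms by (auto simp: ac_deriv_on_def)
  obtain M where M: "M > 0" "\<And>x. x \<in> {a..b} \<Longrightarrow> cmod (h x) \<le> M"
    using abs_cont_on_bounded[OF ac(1)] by blast
  obtain M' where M': "M' > 0" "\<And>x. x \<in> {a..b} \<Longrightarrow> cmod (h' x) \<le> M'"
    using abs_cont_on_bounded[OF ac(2)] by blast
  show "abs_cont_on a b (\<lambda>x. h x * h' x)"
  proof (rule abs_cont_on_combine[OF ac, where K = "M + M'"])
    fix s t assume st: "a \<le> s" "s \<le> t" "t \<le> b"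
    have "h t * h' t - h s * h' s = (h t - h s) * h' t + h s * (h' t - h' s)"
      by (simp add: algebra_simps)
    then have "cmod (h t * h' t - h s * h' s) \<le> cmod (h t - h s) * cmod (h' t) + cmod (h s) * cmod (h' t - h' s)"
      by (metis norm_mult norm_triangle_ineq)
    also have "\<dots> \<le> cmod (h t - h s) * (M + M') + (M + M') * cmod (h' t - h' s)"
      using M(2)[of s] M'(2)[of t] M(1) M'(1) st by (intro add_mono mult_mono) auto
    finally show "cmod (h t * h' t - h s * h' s) \<le> (M + M') * (cmod (h t - h s) + cmod (h' t - h' s))"
      by (simp add: algebra_simps)
  qed (use M M' in auto)
  show "AE x in lborel. x \<in> {a..b} \<longrightarrow> ((\<lambda>x. h x * h' x) has_vector_derivative h x * k' x + k x * h' x) (at x)"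
    using assms unfolding ac_deriv_on_def
    by (auto elim!: eventually_elim2 intro!: has_vector_derivative_mult)
qed

lemma ac_deriv_on_inverse:
  assumes "ac_deriv_on a b h k" "\<delta> > 0" "\<And>x. x \<in> {a..b} \<Longrightarrow> cmod (h x) \<ge> \<delta>"
  shows "ac_deriv_on a b (\<lambda>x. inverse (h x)) (\<lambda>x. - k x / (h x)\<^sup>2)"
  unfolding ac_deriv_on_def
proof
  have ac: "abs_cont_on a b h" using assms by (auto simp: ac_deriv_on_def)
  show "abs_cont_on a b (\<lambda>x. inverse (h x))"
  proof (rule abs_cont_on_combine[OF ac ac, where K = "inverse \<delta> * inverse \<delta>"])
    fix s t assume st: "a \<le> s" "s \<le> t" "t \<le> b"
    have nz: "h s \<noteq> 0" "h t \<noteq> 0" using assms(2) assms(3)[of s] assms(3)[of t] st by auto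
    have "cmod (inverse (h t) - inverse (h s)) = cmod (h t - h s) * (inverse (cmod (h t)) * inverse (cmod (h s)))"
      using nz by (simp add: inverse_diff_inverse norm_mult norm_inverse)
    also have "\<dots> \<le> cmod (h t - h s) * (inverse \<delta> * inverse \<delta>)"
      using assms(2) assms(3)[of s] assms(3)[of t] st by (intro mult_left_mono mult_mono le_imp_inverse_le) auto
    also have "\<dots> \<le> inverse \<delta> * inverse \<delta> * (cmod (h t - h s) + cmod (h t - h s))"
      using assms(2) by (simp add: algebra_simps)
    finally show "cmod (inverse (h t) - inverse (h s)) \<le> inverse \<delta> * inverse \<delta> * (cmod (h t - h s) + cmod (h t - h s))" .
  qed (use assms in auto)
  have "((\<lambda>x. inverse (h x)) has_vector_derivative - k x / (h x)\<^sup>2) (at x)"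
    if x: "x \<in> {a..b}" "(h has_vector_derivative k x) (at x)" for x
  proof -
    have "h x \<noteq> 0" using assms(2) assms(3)[of x] x by auto
    then have "(inverse has_field_derivative - (inverse (h x) ^ Suc (Suc 0))) (at (h x))"
      by (rule DERIV_inverse)
    from field_vector_diff_chain_at[OF x(2) this] show ?thesis
      by (simp add: o_def power2_eq_square field_simps)
  qed
  then show "AE x in lborel. x \<in> {a..b} \<longrightarrow> ((\<lambda>x. inverse (h x)) has_vector_derivative - k x / (h x)\<^sup>2) (at x)"
    using assms unfolding ac_deriv_on_def by (auto elim!: eventually_mono)
qed

lemma ac_deriv_on_C1:
  assumes der: "\<And>x. x \<in> {a..b} \<Longrightarrow> (h has_vector_derivative k x) (at x within {a..b})"
    and k: "continuous_on {a..b} k"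
  shows "ac_deriv_on a b h k"
  unfolding ac_deriv_on_def
proof
  have "bounded (k ` {a..b})"
    using k compact_continuous_image compact_imp_bounded by blast
  then obtain M where M: "M > 0" "\<And>x. x \<in> {a..b} \<Longrightarrow> cmod (k x) \<le> M"
    unfolding bounded_pos by auto
  show "abs_cont_on a b h"
  proof (rule abs_cont_on_lipschitz)
    fix s t assume st: "a \<le> s" "s \<le> t" "t \<le> b"
    have "(k has_integral (h t - h s)) {s..t}"
      using st by (intro fundamental_theorem_of_calculus has_vector_derivative_within_subset[OF der]) auto
    then have "cmod (h t - h s) \<le> M * measure lborel {s..t}"
      using has_integral_bound[of M k "h t - h s" s t] M st by auto
    then show "cmod (h t - h s) \<le> M * (t - s)" using st by simp
  qed (use M in auto)
  show "AE x in lborel. x \<in> {a..b} \<longrightarrow> (h has_vector_derivative k x) (at x)"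
  proof (rule AE_of_negligible[of "{a, b}"])
    fix x assume "x \<notin> {a, b}"
    then show "x \<in> {a..b} \<longrightarrow> (h has_vector_derivative k x) (at x)"
      using der[of x] at_within_Icc_at[of a x b] by auto
  qed simp
qed

text \<open>An absolutely continuous function is the integral of its derivative, so an a.e. sign of
  the derivative suffices. Monotonicity of the energy and of the auxiliary functions
  \<open>H\<close> below is obtained in this way.\<close>

lemma ac_deriv_on_mono:
  assumes h: "ac_deriv_on a b h k" and ab: "a \<le> b"
    and k: "AE x in lborel. x \<in> {a..b} \<longrightarrow> 0 \<le> Re (k x)"
  shows "Re (h a) \<le> Re (h b)"
proof -
  obtain N where N: "negligible N" "\<And>x. x \<notin> N \<Longrightarrow> x \<in> {a..b} \<longrightarrow> 0 \<le> Re (k x)"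
    using k by (rule negligible_of_AE) blast
  have "((\<lambda>x. Re (k x)) has_integral (Re (h b - h a))) {a..b}"
    using has_integral_linear[OF ac_deriv_on_has_integral[OF h ab] bounded_linear_Re] by (simp add: o_def)
  then have "((\<lambda>x. max 0 (Re (k x))) has_integral (Re (h b - h a))) {a..b}"
    by (rule has_integral_spike[OF N(1), rotated]) (use N(2) in auto)
  then have "0 \<le> Re (h b - h a)" by (rule has_integral_nonneg) auto
  then show ?thesis by simp
qed

text \<open>Only monotonicity of the integral is applied to \<open>r\<close>, which will contain
  \<open>dp\<close>. The majorant \<open>max 0 (Re (k x))\<close> has a known integral, the
  increment of \<open>h\<close>.\<close>

lemma nn_integral_le_ac_deriv:
  assumes h: "ac_deriv_on a b h k" and ab: "a \<le> b"
    and k: "AE x in lborel. x \<in> {a..b} \<longrightarrow> 0 \<le> Re (k x) \<and> r x \<le> Re (k x)"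
  shows "(\<integral>\<^sup>+x\<in>{a..b}. ennreal (r x) \<partial>lborel) \<le> ennreal (Re (h b) - Re (h a))"
proof -
  obtain N where N: "negligible N" "\<And>x. x \<notin> N \<Longrightarrow> x \<in> {a..b} \<longrightarrow> 0 \<le> Re (k x) \<and> r x \<le> Re (k x)"
    using k by (rule negligible_of_AE) blast
  have "((\<lambda>x. Re (k x)) has_integral (Re (h b - h a))) {a..b}"
    using has_integral_linear[OF ac_deriv_on_has_integral[OF h ab] bounded_linear_Re] by (simp add: o_def)
  then have I: "((\<lambda>x. max 0 (Re (k x))) has_integral (Re (h b - h a))) {a..b}"
    by (rule has_integral_spike[OF N(1), rotated]) (use N(2) in auto)
  have "(\<integral>\<^sup>+x\<in>{a..b}. ennreal (r x) \<partial>lborel) \<le> (\<integral>\<^sup>+x\<in>{a..b}. ennreal (max 0 (Re (k x))) \<partial>lborel)"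
  proof (rule nn_integral_mono_AE)
    show "AE x in lborel. ennreal (r x) * indicator {a..b} x \<le> ennreal (max 0 (Re (k x))) * indicator {a..b} x"
      by (rule AE_of_negligible[OF N(1)]) (use N(2) in \<open>auto simp: indicator_def intro!: ennreal_leI\<close>)
  qed
  also have "\<dots> = ennreal (Re (h b - h a))"
    by (rule nn_integral_has_integral_lebesgue'[OF _ I]) auto
  finally show ?thesis by simp
qed

section \<open>Indefinite integrals\<close>

text \<open>Absolute continuity of the integral: the truncation \<open>min (h x) n\<close>
  contributes at most \<open>n\<close> times the measure of \<open>A\<close>, and the remainder has
  small integral over the whole line.\<close>

lemma set_integral_small:
  fixes h :: "real \<Rightarrow> real"
  assumes h: "integrable lborel h" and nn: "\<And>x. 0 \<le> h x" and \<epsilon>: "\<epsilon> > 0"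
  obtains \<delta> where "\<delta> > 0"
    "\<And>A. A \<in> sets borel \<Longrightarrow> emeasure lborel A < ennreal \<delta> \<Longrightarrow> (LINT x:A|lborel. h x) < \<epsilon>"
proof -
  have [measurable]: "h \<in> borel_measurable lborel" using h by auto
  have lim: "(\<lambda>n. (LINT x|lborel. min (h x) (real n))) \<longlonglongrightarrow> (LINT x|lborel. h x)"
  proof (rule integral_dominated_convergence[where w = h])
    have "(\<lambda>n. min (h x) (real n)) \<longlonglongrightarrow> h x" for x
    proof (rule tendsto_eventually)
      obtain m :: nat where "h x \<le> real m" using real_arch_simple by blast
      then show "\<forall>\<^sub>F n in sequentially. min (h x) (real n) = h x"
        unfolding eventually_sequentially by (intro exI[of _ m]) auto
    qed
    then show "AE x in lborel. (\<lambda>n. min (h x) (real n)) \<longlonglongrightarrow> h x" by simp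
  qed (use h nn in auto)
  obtain n where n: "\<bar>(LINT x|lborel. min (h x) (real n)) - (LINT x|lborel. h x)\<bar> < \<epsilon> / 2"
    using lim[unfolded LIMSEQ_iff, rule_format, of "\<epsilon> / 2"] \<epsilon> by auto
  have im: "integrable lborel (\<lambda>x. min (h x) (real n))"
    by (rule Bochner_Integration.integrable_bound[OF h]) (use nn in auto)
  define \<delta> where "\<delta> = \<epsilon> / 2 / (real n + 1)"
  show thesis
  proof (rule that)
    show "\<delta> > 0" using \<epsilon> by (simp add: \<delta>_def)
    fix A :: "real set" assume A[measurable]: "A \<in> sets borel" and lt: "emeasure lborel A < ennreal \<delta>"
    have fin: "emeasure lborel A < \<infinity>" using lt by (simp add: less_top order.strict_trans)
    have "emeasure lborel A = ennreal (measure lborel A)"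
      using fin by (intro emeasure_eq_ennreal_measure) auto
    then have mA: "measure lborel A < \<delta>"
      using lt by (simp add: ennreal_less_iff)
    have iA: "integrable lborel (\<lambda>x. indicat_real A x)" using fin A by simp
    have "(LINT x:A|lborel. h x) \<le> (LINT x|lborel. (h x - min (h x) (real n)) + real n * indicat_real A x)"
      unfolding set_lebesgue_integral_def
      using h im iA nn integrable_mult_indicator[OF _ h, of A]
      by (intro integral_mono) (auto simp: indicator_def)
    also have "\<dots> = ((LINT x|lborel. h x) - (LINT x|lborel. min (h x) (real n))) + real n * measure lborel A"
      using h im iA by simp
    also have "\<dots> < \<epsilon> / 2 + (real n + 1) * \<delta>"
    proof -
      have "real n * measure lborel A \<le> real n * \<delta>" using mA by (intro mult_left_mono) auto
      also have "\<dots> \<le> (real n + 1) * \<delta>" using \<open>\<delta> > 0\<close> by simp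
      finally show ?thesis using n by linarith
    qed
    also have "\<dots> = \<epsilon>"
      using nonzero_eq_divide_eq[of "real n + 1" \<delta> "\<epsilon> / 2"] by (simp add: \<delta>_def mult.commute)
    finally show "(LINT x:A|lborel. h x) < \<epsilon>" .
  qed
qed

lemma abs_cont_on_indefinite_integral:
  fixes f F :: "real \<Rightarrow> complex"
  assumes f: "set_integrable lborel {a..b} f"
    and F: "\<And>s t. a \<le> s \<Longrightarrow> s \<le> t \<Longrightarrow> t \<le> b \<Longrightarrow> F t - F s = integral {s..t} f"
  shows "abs_cont_on a b F"
  unfolding abs_cont_on_def
proof (intro allI impI)
  fix \<epsilon> :: real assume "\<epsilon> > 0"
  define h where "h x = indicator {a..b} x * cmod (f x)" for x
  have hi: "integrable lborel h"
    using integrable_norm[OF f[unfolded set_integrable_def]] by (simp add: h_def[abs_def] abs_mult)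
  have h0: "0 \<le> h x" for x by (simp add: h_def)
  obtain \<delta> where \<delta>: "\<delta> > 0"
    "\<And>A. A \<in> sets borel \<Longrightarrow> emeasure lborel A < ennreal \<delta> \<Longrightarrow> (LINT x:A|lborel. h x) < \<epsilon>"
    using set_integral_small[OF hi h0 \<open>\<epsilon> > 0\<close>] by blast
  have hset: "set_integrable lborel A h" if "A \<in> sets borel" for A
    using integrable_mult_indicator[OF _ hi, of A] that by (simp add: set_integrable_def)
  have le: "cmod (F t - F s) \<le> (LINT x:{s<..t}|lborel. h x)" if st: "a \<le> s" "s \<le> t" "t \<le> b" for s t
  proof -
    have fst: "set_integrable lborel {s..t} f"
      by (rule set_integrable_subset[OF f]) (use st in auto)
    have "cmod (F t - F s) = cmod (LINT x:{s..t}|lborel. f x)"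
      using F[OF st] set_borel_integral_eq_integral(2)[OF fst] by simp
    also have "\<dots> \<le> (LINT x:{s..t}|lborel. cmod (f x))"
      by (rule set_integral_norm_bound[OF fst])
    also have "\<dots> = (LINT x:{s..t}|lborel. h x)"
      using st by (intro set_lebesgue_integral_cong) (auto simp: h_def)
    also have "\<dots> = (LINT x:{s<..t}|lborel. h x)"
      unfolding set_lebesgue_integral_def
    proof (rule integral_cong_AE)
      show "AE x in lborel. indicat_real {s..t} x *\<^sub>R h x = indicat_real {s<..t} x *\<^sub>R h x"
        by (rule AE_of_negligible[of "{s}"]) (auto simp: indicator_def)
    qed (use hi in auto)
    finally show ?thesis .
  qed
  have "(\<Sum>i<n. cmod (F (t i) - F (s i))) < \<epsilon>"
    if st: "\<forall>i<n. a \<le> s i \<and> s i \<le> t i \<and> t i \<le> b"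
      and ord: "\<forall>i<n. \<forall>j<n. i \<noteq> j \<longrightarrow> t i \<le> s j \<or> t j \<le> s i"
      and len: "(\<Sum>i<n. t i - s i) < \<delta>" for n and s t :: "nat \<Rightarrow> real"
  proof -
    \<comment> \<open>Neighbouring intervals may share an endpoint; half-open intervals are disjoint
      nevertheless.\<close>
    have disj: "disjoint_family_on (\<lambda>i. {s i<..t i}) {..<n}"
      using ord by (fastforce simp: disjoint_family_on_def)
    have "(\<Sum>i<n. cmod (F (t i) - F (s i))) \<le> (\<Sum>i<n. (LINT x:{s i<..t i}|lborel. h x))"
      using st le by (intro sum_mono) auto
    also have "\<dots> = (LINT x:(\<Union>i<n. {s i<..t i})|lborel. h x)"
      by (rule set_integral_finite_Union[symmetric]) (use disj hset in auto)
    also have "\<dots> < \<epsilon>"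
    proof (rule \<delta>(2))
      have "emeasure lborel (\<Union>i<n. {s i<..t i}) = (\<Sum>i<n. emeasure lborel {s i<..t i})"
        using disj by (intro sum_emeasure[symmetric]) auto
      also have "\<dots> = (\<Sum>i<n. ennreal (t i - s i))"
        using st by (intro sum.cong) auto
      also have "\<dots> = ennreal (\<Sum>i<n. t i - s i)"
        using st by (intro sum_ennreal) auto
      also have "\<dots> < ennreal \<delta>"
        using len st by (intro ennreal_lessI) (use \<delta>(1) in auto)
      finally show "emeasure lborel (\<Union>i<n. {s i<..t i}) < ennreal \<delta>" .
    qed auto
    finally show ?thesis .
  qed
  then show "\<exists>\<delta>>0. \<forall>(n::nat) (s::nat \<Rightarrow> real) (t::nat \<Rightarrow> real).
        (\<forall>i<n. a \<le> s i \<and> s i \<le> t i \<and> t i \<le> b) \<and>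
        (\<forall>i<n. \<forall>j<n. i \<noteq> j \<longrightarrow> t i \<le> s j \<or> t j \<le> s i) \<and>
        (\<Sum>i<n. t i - s i) < \<delta>
        \<longrightarrow> (\<Sum>i<n. cmod (F (t i) - F (s i))) < \<epsilon>"
    using \<delta>(1) by blast
qed

text \<open>Lebesgue differentiation on the intervals \<open>[x, x + h]\<close>, multiplied by
  \<open>h\<close> to match the error term in the definition of the derivative.\<close>

lemma indefinite_integral_right_derivative:
  fixes f :: "real \<Rightarrow> complex"
  assumes "\<And>a b. f integrable_on {a..b}"
  obtains N where "negligible N" "\<And>x e. x \<notin> N \<Longrightarrow> 0 < e \<Longrightarrow>
    \<exists>d>0. \<forall>h. 0 < h \<and> h < d \<longrightarrow> cmod (integral {x..x+h} f - h *\<^sub>R f x) \<le> e * h"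
proof -
  obtain N where N: "negligible N" "\<And>x e. x \<notin> N \<Longrightarrow> 0 < e \<Longrightarrow>
    \<exists>d>0. \<forall>h. 0 < h \<and> h < d \<longrightarrow> cmod (integral (cbox x (x + h *\<^sub>R One)) f /\<^sub>R h ^ DIM(real) - f x) < e"
    using integrable_ccontinuous_explicit[of f] assms by auto
  have conv: "cmod (integral {x..x+h} f - h *\<^sub>R f x) \<le> e * h"
    if "0 < h" "cmod (integral (cbox x (x + h *\<^sub>R One)) f /\<^sub>R h ^ DIM(real) - f x) < e" for x h e
  proof -
    have "integral {x..x+h} f - h *\<^sub>R f x = h *\<^sub>R (integral {x..x+h} f /\<^sub>R h - f x)"
      using that(1) by (simp add: scaleR_diff_right)
    then have "cmod (integral {x..x+h} f - h *\<^sub>R f x) = h * cmod (integral {x..x+h} f /\<^sub>R h - f x)"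
      using that(1) by simp
    also have "\<dots> \<le> h * e" using that by (intro mult_left_mono) auto
    finally show ?thesis by (simp add: mult.commute)
  qed
  show thesis
  proof (rule that[OF N(1)])
    fix x and e :: real assume "x \<notin> N" "0 < e"
    from N(2)[OF this] show "\<exists>d>0. \<forall>h. 0 < h \<and> h < d \<longrightarrow> cmod (integral {x..x+h} f - h *\<^sub>R f x) \<le> e * h"
      using conv by blast
  qed
qed

text \<open>The library only provides right difference quotients; the left ones are obtained by reflection.\<close>
lemma indefinite_integral_has_vector_derivative:
  fixes f F :: "real \<Rightarrow> complex"
  assumes f: "\<And>a b. f integrable_on {a..b}"
    and F: "\<And>s t. a \<le> s \<Longrightarrow> s \<le> t \<Longrightarrow> t \<le> b \<Longrightarrow> F t - F s = integral {s..t} f"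
  shows "AE x in lborel. x \<in> {a..b} \<longrightarrow> (F has_vector_derivative f x) (at x)"
proof -
  obtain N where N: "negligible N" "\<And>x e. x \<notin> N \<Longrightarrow> 0 < e \<Longrightarrow>
    \<exists>d>0. \<forall>h. 0 < h \<and> h < d \<longrightarrow> cmod (integral {x..x+h} f - h *\<^sub>R f x) \<le> e * h"
    using indefinite_integral_right_derivative[OF f] by blast
  have f': "(\<lambda>x. f (- x)) integrable_on {a..b}" for a b
    using f[of "-b" "-a"] Henstock_Kurzweil_Integration.integrable_reflect_real[of f "- a" "-b"] by simp
  obtain N' where N': "negligible N'" "\<And>x e. x \<notin> N' \<Longrightarrow> 0 < e \<Longrightarrow>
    \<exists>d>0. \<forall>h. 0 < h \<and> h < d \<longrightarrow> cmod (integral {x..x+h} (\<lambda>x. f (- x)) - h *\<^sub>R f (- x)) \<le> e * h"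
    using indefinite_integral_right_derivative[OF f'] by blast
  have N'': "negligible (uminus ` N')"
    by (rule negligible_differentiable_image_negligible[OF _ N'(1)]) (auto intro!: derivative_intros)
  show ?thesis
  proof (rule AE_of_negligible[of "N \<union> uminus ` N' \<union> {a, b}"])
    show "negligible (N \<union> uminus ` N' \<union> {a, b})"
      using N(1) N'' by auto
    fix x assume x: "x \<notin> N \<union> uminus ` N' \<union> {a, b}"
    then have x': "x \<notin> N" "- x \<notin> N'" "x \<noteq> a" "x \<noteq> b" by force+
    show "x \<in> {a..b} \<longrightarrow> (F has_vector_derivative f x) (at x)"
    proof
      assume "x \<in> {a..b}"
      then have ab: "a < x" "x < b" using x' by auto
      show "(F has_vector_derivative f x) (at x)"
        unfolding has_vector_derivative_def has_derivative_at_alt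
      proof (intro conjI allI impI bounded_linear_scaleR_left)
        fix e :: real assume e: "e > 0"
        obtain d where d: "d > 0" "\<And>h. 0 < h \<Longrightarrow> h < d \<Longrightarrow> cmod (integral {x..x+h} f - h *\<^sub>R f x) \<le> e * h"
          using N(2)[OF x'(1) e] by blast
        obtain d' where d': "d' > 0" "\<And>h. 0 < h \<Longrightarrow> h < d' \<Longrightarrow>
            cmod (integral {- x..- x+h} (\<lambda>x. f (- x)) - h *\<^sub>R f x) \<le> e * h"
          using N'(2)[OF x'(2) e] by auto
        have "norm (F y - F x - (y - x) *\<^sub>R f x) \<le> e * norm (y - x)"
          if y: "norm (y - x) < Min {d, d', x - a, b - x}" for y
        proof -
          consider "y = x" | "x < y" | "y < x" by linarith
          then show ?thesis
          proof cases
            case 2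
            then have "F y - F x = integral {x..x + (y - x)} f"
              using F[of x y] ab y by auto
            then show ?thesis using d(2)[of "y - x"] 2 y by auto
          next
            case 3
            have "F x - F y = integral {y..x} f" using F[of y x] ab y 3 by auto
            also have "\<dots> = integral {- x..- x + (x - y)} (\<lambda>x. f (- x))"
              using Henstock_Kurzweil_Integration.integral_reflect_real[of x y f] by simp
            finally have "cmod (F x - F y - (x - y) *\<^sub>R f x) \<le> e * (x - y)"
              using d'(2)[of "x - y"] 3 y by auto
            moreover have "F y - F x - (y - x) *\<^sub>R f x = - (F x - F y - (x - y) *\<^sub>R f x)"
              by (simp add: algebra_simps)
            ultimately show ?thesis using 3 by (metis abs_minus_commute abs_of_pos diff_gt_0_iff_gt norm_minus_cancel real_norm_def)
          qed auto
        qed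
        moreover have "0 < Min {d, d', x - a, b - x}" using d d' ab by auto
        ultimately show "\<exists>d>0. \<forall>y. norm (y - x) < d \<longrightarrow> norm (F y - F x - (y - x) *\<^sub>R f x) \<le> e * norm (y - x)"
          by blast
      qed
    qed
  qed
qed

lemma ac_deriv_on_indefinite_integral:
  fixes f :: "real \<Rightarrow> complex"
  assumes f: "\<And>b. set_integrable lborel {0..b} f"
  defines "F \<equiv> \<lambda>x. integral {0..x} f"
  shows "ac_deriv_on 0 b F f"
proof -
  \<comment> \<open>Extension by zero makes the function integrable over every interval, including
    those reaching left of \<open>0\<close>, as the differentiation lemma demands.\<close>
  define f0 where "f0 x = (if x \<in> {0..} then f x else 0)" for x
  have fi: "f integrable_on {0..b}" for b
    using set_borel_integral_eq_integral(1)[OF f] .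
  have f0i: "f0 integrable_on {a..b}" for a b
  proof -
    have "f integrable_on {a..b} \<inter> {0..}"
    proof -
      have "{a..b} \<inter> {0..} = {max a 0..b}" by auto
      then show ?thesis using integrable_on_subinterval[OF fi[of b], of "max a 0" b] by simp
    qed
    then show ?thesis
      unfolding f0_def by (subst integrable_restrict_Int) (simp add: Int_commute)
  qed
  have Fd: "F t - F s = integral {s..t} f" if "0 \<le> s" "s \<le> t" for s t
    using Henstock_Kurzweil_Integration.integral_combine[OF that fi] by (simp add: F_def algebra_simps)
  have Fd0: "F t - F s = integral {s..t} f0" if "0 \<le> s" "s \<le> t" for s t
    unfolding Fd[OF that] by (rule integral_cong) (use that in \<open>auto simp: f0_def\<close>)
  have "abs_cont_on 0 b F"
    by (rule abs_cont_on_indefinite_integral[OF f]) (use Fd in auto)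
  moreover have "AE x in lborel. x \<in> {0..b} \<longrightarrow> (F has_vector_derivative f0 x) (at x)"
    by (rule indefinite_integral_has_vector_derivative[OF f0i]) (use Fd0 in auto)
  then have "AE x in lborel. x \<in> {0..b} \<longrightarrow> (F has_vector_derivative f x) (at x)"
    by eventually_elim (auto simp: f0_def)
  ultimately show ?thesis by (simp add: ac_deriv_on_def)
qed

lemma ac_deriv_on_primitive:
  fixes h :: "real \<Rightarrow> real"
  assumes h: "set_integrable lborel {0..} h" and nn: "\<And>x. 0 \<le> x \<Longrightarrow> 0 \<le> h x"
  shows "ac_deriv_on 0 b (\<lambda>x. of_real (integral {0..x} h)) (\<lambda>x. of_real (h x))"
    and "0 \<le> integral {0..x} h" and "integral {0..x} h \<le> (LINT x:{0..}|lborel. h x)"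
proof -
  have hc: "set_integrable lborel {0..c} h" for c
    by (rule set_integrable_subset[OF h]) auto
  have hi: "h integrable_on {0..c}" for c
    using set_borel_integral_eq_integral(1)[OF hc] .
  have "set_integrable lborel {0..c} (\<lambda>x. complex_of_real (h x))" for c
    using integrable_of_real[OF hc[of c, unfolded set_integrable_def], where 'a = complex]
    by (simp add: set_integrable_def scaleR_conv_of_real)
  then have "ac_deriv_on 0 b (\<lambda>x. integral {0..x} (\<lambda>x. complex_of_real (h x))) (\<lambda>x. of_real (h x))"
    by (rule ac_deriv_on_indefinite_integral)
  moreover have "integral {0..x} (\<lambda>x. complex_of_real (h x)) = of_real (integral {0..x} h)" for x
    using integral_linear[OF hi bounded_linear_of_real] by (simp add: o_def)
  ultimately show "ac_deriv_on 0 b (\<lambda>x. of_real (integral {0..x} h)) (\<lambda>x. of_real (h x))"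
    by simp
  show "0 \<le> integral {0..x} h"
    using hi nn by (intro Henstock_Kurzweil_Integration.integral_nonneg) auto
  have "integral {0..x} h = (LINT x:{0..x}|lborel. h x)"
    using set_borel_integral_eq_integral(2)[OF hc] by simp
  also have "\<dots> \<le> (LINT x:{0..}|lborel. h x)"
    unfolding set_lebesgue_integral_def
    using h hc[of x] nn unfolding set_integrable_def by (intro integral_mono) (auto simp: indicator_def)
  finally show "integral {0..x} h \<le> (LINT x:{0..}|lborel. h x)" .
qed

lemma set_integrable_of_nn_integral:
  fixes h :: "real \<Rightarrow> real"
  assumes [measurable]: "(\<lambda>x. indicat_real {0..} x * h x) \<in> borel_measurable borel"
    and nn: "\<And>x. 0 \<le> x \<Longrightarrow> 0 \<le> h x"
    and fin: "(\<integral>\<^sup>+x\<in>{0..}. ennreal (h x) \<partial>lborel) < \<infinity>"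
  shows "set_integrable lborel {0..} h"
proof -
  have eq: "(\<integral>\<^sup>+x\<in>{0..}. ennreal (h x) \<partial>lborel) = (\<integral>\<^sup>+x. ennreal (indicat_real {0..} x * h x) \<partial>lborel)"
    by (intro nn_integral_cong) (auto simp: indicator_def)
  have i: "integrable lborel (\<lambda>x. indicat_real {0..} x * h x)"
  proof (rule integrableI_nonneg)
    show "(\<integral>\<^sup>+x. ennreal (indicat_real {0..} x * h x) \<partial>lborel) < \<infinity>"
      using fin unfolding eq .
    show "AE x in lborel. 0 \<le> indicat_real {0..} x * h x"
      by (rule AE_I2) (use nn in \<open>simp add: indicator_def\<close>)
    show "(\<lambda>x. indicat_real {0..} x * h x) \<in> borel_measurable lborel"
      using assms(1) by simp
  qed
  then show ?thesis by (simp add: set_integrable_def)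
qed

text \<open>Monotone convergence is applied to the simple functions below the integrand rather than
  to the integrand, because the latter will contain \<open>rho\<close>. Such a simple function
  vanishes for negative arguments, hence is the supremum of its truncations to
  \<open>{0..real n}\<close>.\<close>

lemma nn_integral_atLeast_le:
  fixes f :: "real \<Rightarrow> ennreal"
  assumes le: "\<And>n::nat. (\<integral>\<^sup>+x\<in>{0..real n}. f x \<partial>lborel) \<le> c"
  shows "(\<integral>\<^sup>+x\<in>{0..}. f x \<partial>lborel) \<le> c"
  unfolding nn_integral_def[of lborel "\<lambda>x. f x * indicator {0..} x"]
proof (rule SUP_least, clarify)
  fix g :: "real \<Rightarrow> ennreal"
  assume g: "simple_function lborel g" and gf: "g \<le> (\<lambda>x. f x * indicator {0..} x)"
  have [measurable]: "g \<in> borel_measurable lborel" using g by (rule borel_measurable_simple_function)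
  have gx: "g x \<le> f x * indicator {0..} x" for x using gf by (simp add: le_fun_def)
  have sup: "g x = (SUP n. g x * indicator {0..real n} x)" for x
  proof (rule antisym)
    show "(SUP n. g x * indicator {0..real n} x) \<le> g x"
      by (rule SUP_least) (auto simp: indicator_def)
    show "g x \<le> (SUP n. g x * indicator {0..real n} x)"
    proof (cases "0 \<le> x")
      case True
      obtain n :: nat where "x \<le> real n" using real_arch_simple by blast
      then have "g x = g x * indicator {0..real n} x" using True by simp
      then show ?thesis by (metis SUP_upper UNIV_I)
    next
      case False
      then show ?thesis using gx[of x] by simp
    qed
  qed
  have "integral\<^sup>S lborel g = (\<integral>\<^sup>+x. g x \<partial>lborel)"
    using g by (rule nn_integral_eq_simple_integral[symmetric])
  also have "\<dots> = (\<integral>\<^sup>+x. (SUP n. g x * indicator {0..real n} x) \<partial>lborel)"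
    using sup by simp
  also have "\<dots> = (SUP n. (\<integral>\<^sup>+x. g x * indicator {0..real n} x \<partial>lborel))"
    by (rule nn_integral_monotone_convergence_SUP)
      (auto simp: incseq_def le_fun_def indicator_def)
  also have "\<dots> \<le> c"
  proof (rule SUP_least)
    fix n :: nat
    have "(\<integral>\<^sup>+x. g x * indicator {0..real n} x \<partial>lborel) \<le> (\<integral>\<^sup>+x\<in>{0..real n}. f x \<partial>lborel)"
    proof (rule nn_integral_mono)
      fix x show "g x * indicator {0..real n} x \<le> f x * indicator {0..real n} x"
        using gx[of x] by (auto simp: indicator_def split: if_splits)
    qed
    then show "(\<integral>\<^sup>+x. g x * indicator {0..real n} x \<partial>lborel) \<le> c"
      using le[of n] by (rule order_trans)
  qed
  finally show "integral\<^sup>S lborel g \<le> c" .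
qed

section \<open>Square-integrable functions\<close>

lemma L2_plus_zero: "L2_plus (\<lambda>_. 0)"
  by (simp add: L2_plus_def set_borel_measurable_def)

lemma L2_plus_set_integrable:
  assumes "L2_plus f"
  shows "set_integrable lborel {0..} (\<lambda>x. (cmod (f x))\<^sup>2)"
proof (rule set_integrable_of_nn_integral)
  have [measurable]: "(\<lambda>x. indicat_real {0..} x *\<^sub>R f x) \<in> borel_measurable borel"
    using assms by (simp add: L2_plus_def set_borel_measurable_def)
  have "(\<lambda>x. (cmod (indicat_real {0..} x *\<^sub>R f x))\<^sup>2) \<in> borel_measurable borel" by measurable
  also have "(\<lambda>x. (cmod (indicat_real {0..} x *\<^sub>R f x))\<^sup>2) = (\<lambda>x. indicat_real {0..} x * (cmod (f x))\<^sup>2)"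
    by (auto simp: indicator_def)
  finally show "(\<lambda>x. indicat_real {0..} x * (cmod (f x))\<^sup>2) \<in> borel_measurable borel" .
  show "(\<integral>\<^sup>+x\<in>{0..}. ennreal ((cmod (f x))\<^sup>2) \<partial>lborel) < \<infinity>"
    using assms by (simp only: L2_plus_def)
qed simp

text \<open>On a bounded interval \<open>1 + |f|^2\<close> is an integrable majorant of
  \<open>|f|\<close>.\<close>

lemma L2_plus_locally_integrable:
  assumes "L2_plus f" shows "set_integrable lborel {0..b} f"
proof -
  have m: "set_borel_measurable lborel {0..b} f"
  proof -
    have [measurable]: "(\<lambda>x. indicat_real {0..} x *\<^sub>R f x) \<in> borel_measurable borel"
      using assms by (simp add: L2_plus_def set_borel_measurable_def)
    have "(\<lambda>x. indicat_real {0..b} x *\<^sub>R (indicat_real {0..} x *\<^sub>R f x)) \<in> borel_measurable borel"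
      by measurable
    also have "(\<lambda>x. indicat_real {0..b} x *\<^sub>R (indicat_real {0..} x *\<^sub>R f x)) = (\<lambda>x. indicat_real {0..b} x *\<^sub>R f x)"
      by (auto simp: indicator_def)
    finally show ?thesis by (simp add: set_borel_measurable_def)
  qed
  have "set_integrable lborel {0..b} (\<lambda>x. 1 + (cmod (f x))\<^sup>2)"
  proof (rule set_integral_add)
    show "set_integrable lborel {0..b} (\<lambda>x. (cmod (f x))\<^sup>2)"
      by (rule set_integrable_subset[OF L2_plus_set_integrable[OF assms]]) auto
    show "set_integrable lborel {0..b} (\<lambda>x. 1 :: real)"
      by (rule borel_integrable_atLeastAtMost') auto
  qed
  then show ?thesis
  proof (rule set_integrable_bound[OF _ m])
    have "cmod z \<le> 1 + (cmod z)\<^sup>2" for z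
      using zero_le_power2[of "cmod z - 1"] norm_ge_zero[of z]
      unfolding power2_diff power_one mult_1_right by linarith
    then show "AE x in lborel. x \<in> {0..b} \<longrightarrow> norm (f x) \<le> norm (1 + (cmod (f x))\<^sup>2)"
      by (auto intro!: AE_I2 order_trans[OF _ abs_ge_self])
  qed
qed

lemma L2_plus_add_cmult:
  assumes f: "L2_plus f" and g: "L2_plus g"
  shows "L2_plus (\<lambda>x. f x + c * g x)"
  unfolding L2_plus_def
proof
  have [measurable]: "(\<lambda>x. indicat_real {0..} x *\<^sub>R f x) \<in> borel_measurable borel"
    "(\<lambda>x. indicat_real {0..} x *\<^sub>R g x) \<in> borel_measurable borel"
    using f g by (simp_all add: L2_plus_def set_borel_measurable_def)
  have "(\<lambda>x. indicat_real {0..} x *\<^sub>R f x + c * (indicat_real {0..} x *\<^sub>R g x)) \<in> borel_measurable borel"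
    by measurable
  then show m: "set_borel_measurable lborel {0..} (\<lambda>x. f x + c * g x)"
    by (simp add: set_borel_measurable_def scaleR_add_right)
  have i: "set_integrable lborel {0..} (\<lambda>x. 2 * (cmod (f x))\<^sup>2 + 2 * (cmod c)\<^sup>2 * (cmod (g x))\<^sup>2)"
    by (intro set_integral_add(1) set_integrable_mult_right L2_plus_set_integrable f g)
  have le: "(cmod (f x + c * g x))\<^sup>2 \<le> 2 * (cmod (f x))\<^sup>2 + 2 * (cmod c)\<^sup>2 * (cmod (g x))\<^sup>2" for x
  proof -
    have "(cmod (f x + c * g x))\<^sup>2 \<le> (cmod (f x) + cmod c * cmod (g x))\<^sup>2"
      by (intro power_mono) (simp_all add: norm_triangle_le norm_mult)
    also have "\<dots> \<le> 2 * (cmod (f x))\<^sup>2 + 2 * (cmod c * cmod (g x))\<^sup>2"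
      using zero_le_power2[of "cmod (f x) - cmod c * cmod (g x)"] unfolding power2_diff power2_sum by linarith
    finally show ?thesis by (simp add: power_mult_distrib)
  qed
  have "(\<integral>\<^sup>+x\<in>{0..}. ennreal ((cmod (f x + c * g x))\<^sup>2) \<partial>lborel)
      \<le> (\<integral>\<^sup>+x. ennreal (indicat_real {0..} x *\<^sub>R (2 * (cmod (f x))\<^sup>2 + 2 * (cmod c)\<^sup>2 * (cmod (g x))\<^sup>2)) \<partial>lborel)"
  proof (rule nn_integral_mono)
    fix x show "ennreal ((cmod (f x + c * g x))\<^sup>2) * indicator {0..} x
        \<le> ennreal (indicat_real {0..} x *\<^sub>R (2 * (cmod (f x))\<^sup>2 + 2 * (cmod c)\<^sup>2 * (cmod (g x))\<^sup>2))"
      using ennreal_leI[OF le] by (cases "0 \<le> x") (simp_all del: ennreal_plus)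
  qed
  also have "\<dots> = ennreal (LINT x:{0..}|lborel. 2 * (cmod (f x))\<^sup>2 + 2 * (cmod c)\<^sup>2 * (cmod (g x))\<^sup>2)"
    unfolding set_lebesgue_integral_def
    by (rule nn_integral_eq_integral[OF i[unfolded set_integrable_def]]) simp
  also have "\<dots> < \<infinity>" by simp
  finally show "(\<integral>\<^sup>+x\<in>{0..}. ennreal ((cmod (f x + c * g x))\<^sup>2) \<partial>lborel) < \<infinity>" .
qed

section \<open>Ordinary differential equations on a half-line\<close>

lemma continuous_on_atLeastI:
  fixes h :: "real \<Rightarrow> 'a::topological_space"
  assumes "\<And>b. continuous_on {a..b} h"
  shows "continuous_on {a..} h"
proof (clarsimp simp: continuous_on_eq_continuous_within)
  fix x assume "a \<le> x"
  have "continuous (at x within {a..x+1}) h"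
    using assms[of "x+1"] \<open>a \<le> x\<close> by (auto simp: continuous_on_eq_continuous_within)
  moreover have "at x within {a..} = at x within {a..x+1}"
    by (rule at_within_nhd[of _ "{..<x+1}"]) (use \<open>a \<le> x\<close> in auto)
  ultimately show "continuous (at x within {a..}) h" by simp
qed

text \<open>Picard iteration is a contraction, on the whole half-line at once, for the supremum norm weighted
  by \<open>exp (- m)\<close> with \<open>m' = 2 \<mu>\<close>.\<close>
lemma lipschitz_ode_exists:
  fixes G :: "real \<Rightarrow> 'a::euclidean_space \<Rightarrow> 'a"
  assumes \<mu>: "continuous_on {0..} \<mu>"
    and lip: "\<And>t u v. 0 \<le> t \<Longrightarrow> norm (G t u - G t v) \<le> \<mu> t * norm (u - v)"
    and G0: "\<And>t. 0 \<le> t \<Longrightarrow> norm (G t 0) \<le> \<mu> t"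
    and cont: "\<And>U. continuous_on {0..} U \<Longrightarrow> continuous_on {0..} (\<lambda>t. G t (U t))"
  obtains Y where "continuous_on {0..} Y"
    "\<And>x. 0 \<le> x \<Longrightarrow> Y x = Y0 + integral {0..x} (\<lambda>t. G t (Y t))"
proof -
  have \<mu>0: "0 \<le> \<mu> t" if "0 \<le> t" for t using G0[OF that] norm_ge_zero order_trans by blast
  define m where "m x = integral {0..x} (\<lambda>t. 2 * \<mu> t)" for x
  have prim: "((\<lambda>x. integral {0..x} h) has_vector_derivative h x) (at x within {0..b})"
    if "continuous_on {0..} h" "x \<in> {0..b}" for h :: "real \<Rightarrow> 'b::banach" and x b
    using that by (intro integral_has_vector_derivative) (auto intro: continuous_on_subset)
  have prim_cont: "continuous_on {0..} (\<lambda>x. integral {0..x} h)"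
    if h: "continuous_on {0..} h" for h :: "real \<Rightarrow> 'b::banach"
    using prim[OF h] by (intro continuous_on_atLeastI)
      (meson continuous_on_eq_continuous_within has_vector_derivative_continuous)
  have \<mu>2: "continuous_on {0..} (\<lambda>t. 2 * \<mu> t)" using \<mu> by (intro continuous_intros)
  have m_cont: "continuous_on {0..} m" unfolding m_def by (rule prim_cont[OF \<mu>2])
  have m_nn: "0 \<le> m x" for x
    unfolding m_def using \<mu>0 by (intro Henstock_Kurzweil_Integration.integral_nonneg
      integrable_continuous_interval continuous_on_subset[OF \<mu>2]) auto
  \<comment> \<open>The choice \<open>m' = 2 * \<mu>\<close> makes this integral explicit; its
    factor one half becomes the contraction constant.\<close>
  have int_w: "((\<lambda>t. \<mu> t * exp (m t)) has_integral (exp (m x) - 1) / 2) {0..x}" if "0 \<le> x" for x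
  proof -
    have "((\<lambda>t. \<mu> t * exp (m t)) has_integral exp (m x) / 2 - exp (m 0) / 2) {0..x}"
    proof (rule fundamental_theorem_of_calculus[OF that])
      fix t assume t: "t \<in> {0..x}"
      have "(m has_real_derivative 2 * \<mu> t) (at t within {0..x})"
        using prim[OF \<mu>2 t] unfolding m_def has_real_derivative_iff_has_vector_derivative .
      then have "((\<lambda>t. exp (m t) / 2) has_real_derivative \<mu> t * exp (m t)) (at t within {0..x})"
        by (auto intro!: derivative_eq_intros)
      then show "((\<lambda>t. exp (m t) / 2) has_vector_derivative \<mu> t * exp (m t)) (at t within {0..x})"
        by (simp add: has_real_derivative_iff_has_vector_derivative)
    qed
    then show ?thesis by (simp add: m_def diff_divide_distrib)
  qed
  \<comment> \<open>The Picard operator in the rescaled unknown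
    \<open>U = exp (- m) * Y\<close>.\<close>
  define P where "P U x = Y0 + integral {0..x} (\<lambda>t. G t (exp (m t) *\<^sub>R U t))" for U :: "real \<Rightarrow> 'a" and x
  have G_cont: "continuous_on {0..} (\<lambda>t. G t (exp (m t) *\<^sub>R U t))" if "continuous_on {0..} U" for U
    using that m_cont by (intro cont continuous_intros)
  have G_int: "(\<lambda>t. G t (exp (m t) *\<^sub>R U t)) integrable_on {0..x}" if "continuous_on {0..} U" for U x
    by (rule integrable_continuous_interval[OF continuous_on_subset[OF G_cont[OF that]]]) auto
  \<comment> \<open>Bounded continuous functions live on the whole line, so the iterate is frozen at
    its value at \<open>0\<close> for negative arguments.\<close>
  define T0 where "T0 U x = exp (- m (max x 0)) *\<^sub>R P U (max x 0)" for U x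
  have T0_cont: "continuous_on UNIV (T0 U)" if U: "continuous_on {0..} U" for U
  proof -
    have "continuous_on {0..} (\<lambda>x. exp (- m x) *\<^sub>R P U x)"
      unfolding P_def using m_cont prim_cont[OF G_cont[OF U]] by (intro continuous_intros)
    then have "continuous_on UNIV (\<lambda>x::real. (\<lambda>x. exp (- m x) *\<^sub>R P U x) (max x 0))"
      by (rule continuous_on_compose2) (auto intro!: continuous_intros)
    then show ?thesis by (simp add: T0_def[abs_def])
  qed
  have scale: "norm (exp (- m x) *\<^sub>R z) \<le> K / 2" if "norm z \<le> K * ((exp (m x) - 1) / 2)" "0 \<le> K" for z :: 'a and K x
  proof -
    have "norm (exp (- m x) *\<^sub>R z) \<le> exp (- m x) * (K * ((exp (m x) - 1) / 2))"
      using that by (simp add: mult_left_mono)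
    also have "\<dots> \<le> exp (- m x) * (K * (exp (m x) / 2))"
      using that(2) by (intro mult_left_mono) auto
    also have "\<dots> = K / 2" by (simp add: exp_minus field_simps)
    finally show ?thesis .
  qed
  have P_lip: "norm (exp (- m x) *\<^sub>R (P U x - P V x)) \<le> K / 2"
    if x: "0 \<le> x" and U: "continuous_on {0..} U" and V: "continuous_on {0..} V"
      and K: "\<And>t. norm (U t - V t) \<le> K" for U V K x
  proof (rule scale)
    show K0: "0 \<le> K" using K[of 0] norm_ge_zero order_trans by blast
    have "norm (integral {0..x} (\<lambda>t. G t (exp (m t) *\<^sub>R U t) - G t (exp (m t) *\<^sub>R V t)))
        \<le> integral {0..x} (\<lambda>t. K * (\<mu> t * exp (m t)))"
    proof (rule integral_norm_bound_integral)
      show "(\<lambda>t. G t (exp (m t) *\<^sub>R U t) - G t (exp (m t) *\<^sub>R V t)) integrable_on {0..x}"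
        by (intro integrable_diff G_int U V)
      show "(\<lambda>t. K * (\<mu> t * exp (m t))) integrable_on {0..x}"
        using has_integral_mult_right[OF int_w[OF x]] by (rule has_integral_integrable)
      fix t assume t: "t \<in> {0..x}"
      have "norm (G t (exp (m t) *\<^sub>R U t) - G t (exp (m t) *\<^sub>R V t)) \<le> \<mu> t * norm (exp (m t) *\<^sub>R (U t - V t))"
        using lip[of t] t by (simp add: scaleR_diff_right)
      also have "\<dots> \<le> \<mu> t * (exp (m t) * K)"
        using K \<mu>0 t by (auto intro!: mult_left_mono)
      finally show "norm (G t (exp (m t) *\<^sub>R U t) - G t (exp (m t) *\<^sub>R V t)) \<le> K * (\<mu> t * exp (m t))"
        by (simp add: mult_ac)
    qed
    also have "\<dots> = K * ((exp (m x) - 1) / 2)"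
      using has_integral_mult_right[OF int_w[OF x]] by (rule integral_unique)
    also have "integral {0..x} (\<lambda>t. G t (exp (m t) *\<^sub>R U t) - G t (exp (m t) *\<^sub>R V t)) = P U x - P V x"
      unfolding P_def using G_int[OF U] G_int[OF V] by (simp add: Henstock_Kurzweil_Integration.integral_diff)
    finally show "norm (P U x - P V x) \<le> K * ((exp (m x) - 1) / 2)" .
  qed
  \<comment> \<open>The bound on \<open>G t 0\<close> keeps the image of zero bounded; with
    \<open>P_lip\<close> it follows that bounded functions are mapped to bounded functions.\<close>
  have P_0: "norm (exp (- m x) *\<^sub>R P (\<lambda>_. 0) x) \<le> norm Y0 + 1 / 2" if x: "0 \<le> x" for x
  proof -
    have "norm (exp (- m x) *\<^sub>R integral {0..x} (\<lambda>t. G t 0)) \<le> 1 / 2"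
    proof (rule scale)
      have "norm (integral {0..x} (\<lambda>t. G t 0)) \<le> integral {0..x} (\<lambda>t. \<mu> t * exp (m t))"
      proof (rule integral_norm_bound_integral)
        show "(\<lambda>t. G t 0) integrable_on {0..x}"
          using G_int[of "\<lambda>_. 0"] by simp
        show "(\<lambda>t. \<mu> t * exp (m t)) integrable_on {0..x}"
          using int_w[OF x] by (rule has_integral_integrable)
        fix t assume t: "t \<in> {0..x}"
        have "norm (G t 0) \<le> \<mu> t * 1" using G0[of t] t by simp
        also have "\<dots> \<le> \<mu> t * exp (m t)"
          using \<mu>0 m_nn t by (intro mult_left_mono) auto
        finally show "norm (G t 0) \<le> \<mu> t * exp (m t)" .
      qed
      then show "norm (integral {0..x} (\<lambda>t. G t 0)) \<le> 1 * ((exp (m x) - 1) / 2)"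
        using int_w[OF x] by (simp add: integral_unique)
    qed simp
    moreover have "norm (exp (- m x) *\<^sub>R Y0) \<le> norm Y0"
      using m_nn[of x] by (simp add: mult_left_le_one_le)
    ultimately show ?thesis
      using norm_triangle_ineq[of "exp (- m x) *\<^sub>R Y0" "exp (- m x) *\<^sub>R integral {0..x} (\<lambda>t. G t 0)"]
      by (simp add: P_def scaleR_add_right)
  qed
  have T0_bound: "norm (T0 U x) \<le> K / 2 + (norm Y0 + 1 / 2)"
    if U: "continuous_on {0..} U" and K: "\<And>t. norm (U t) \<le> K" for U K x
  proof -
    define z where "z = max x 0"
    have "norm (exp (- m z) *\<^sub>R (P U z - P (\<lambda>_. 0) z)) \<le> K / 2"
      by (rule P_lip) (use U K in \<open>auto simp: z_def\<close>)
    moreover have "norm (exp (- m z) *\<^sub>R P (\<lambda>_. 0) z) \<le> norm Y0 + 1 / 2"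
      by (rule P_0) (simp add: z_def)
    moreover have "T0 U x = exp (- m z) *\<^sub>R (P U z - P (\<lambda>_. 0) z) + exp (- m z) *\<^sub>R P (\<lambda>_. 0) z"
      by (simp add: T0_def z_def flip: scaleR_add_right)
    ultimately show ?thesis
      using norm_triangle_ineq[of "exp (- m z) *\<^sub>R (P U z - P (\<lambda>_. 0) z)" "exp (- m z) *\<^sub>R P (\<lambda>_. 0) z"]
      by simp
  qed
  define T where "T U = Bcontfun (T0 (apply_bcontfun U))" for U :: "real \<Rightarrow>\<^sub>C 'a"
  have T: "apply_bcontfun (T U) = T0 (apply_bcontfun U)" for U
  proof -
    have c: "continuous_on {0..} (apply_bcontfun U)" by simp
    have "T0 (apply_bcontfun U) \<in> bcontfun"
      by (rule bcontfun_normI[OF T0_cont[OF c] T0_bound[OF c norm_bounded]])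
    then show ?thesis by (simp add: T_def Bcontfun_inverse)
  qed
  have "dist (T U) (T V) \<le> 1 / 2 * dist U V" for U V
  proof (rule dist_bound)
    fix x
    have "norm (exp (- m (max x 0)) *\<^sub>R (P U (max x 0) - P V (max x 0))) \<le> dist U V / 2"
      by (rule P_lip) (auto simp: dist_bounded simp flip: dist_norm)
    then show "dist (T U x) (T V x) \<le> 1 / 2 * dist U V"
      by (simp add: T T0_def dist_norm flip: scaleR_diff_right)
  qed
  then obtain U where U: "T U = U"
    using banach_fix_type[of "1 / 2" T] by auto
  define Y where "Y x = exp (m x) *\<^sub>R apply_bcontfun U x" for x
  show thesis
  proof
    show "continuous_on {0..} Y"
      unfolding Y_def using m_cont by (intro continuous_intros) auto
    fix x :: real assume x: "0 \<le> x"
    have "apply_bcontfun U x = T0 (apply_bcontfun U) x" using T[of U] U by simp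
    also have "\<dots> = exp (- m x) *\<^sub>R P (apply_bcontfun U) x" using x by (simp add: T0_def)
    finally have "Y x = P (apply_bcontfun U) x" by (simp add: Y_def flip: exp_add)
    then show "Y x = Y0 + integral {0..x} (\<lambda>t. G t (Y t))" by (simp add: P_def Y_def)
  qed
qed

section \<open>The energy inequality\<close>

text \<open>On the negative axis \<open>Arg\<close> equals \<open>pi\<close>, and
  \<open>pi < pi - \<kappa>\<close> is impossible for \<open>\<kappa> \<ge> 0\<close>.\<close>

lemma sector_avoids_nonpos_Reals:
  assumes "0 \<le> \<kappa>" "z \<in> sector \<kappa>" shows "z \<notin> \<real>\<^sub>\<le>\<^sub>0"
proof
  assume "z \<in> \<real>\<^sub>\<le>\<^sub>0"
  then have "Arg z = pi"
    using assms(2) by (auto simp: Arg_eq_pi complex_nonpos_Reals_iff sector_def complex_eq_iff)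
  then show False using assms by (simp add: sector_def)
qed

text \<open>Read \<open>P\<close> as \<open>p\<close>, \<open>D\<close> as \<open>p'\<close>,
  \<open>Y\<close> as \<open>y\<close>, \<open>Y1\<close> as \<open>y'\<close> and \<open>F\<close>
  as \<open>f\<close>: the right-hand side is the derivative of the flux with
  \<open>P\<^sup>2 * Y - F\<close> for \<open>y''\<close>. The square terms are
  \<open>|Y|^2 P\<close> and \<open>|Y1 / P|^2 cnj P\<close>, both with the factor
  \<open>Re P\<close>; the term with \<open>D\<close> is split by the inequality of arithmetic and
  geometric means.\<close>

lemma Re_energy_derivative_ge:
  fixes P D Y Y1 F :: complex
  assumes P: "P \<noteq> 0"
  shows "(Re P - cmod (D / P) / 2) * ((cmod Y)\<^sup>2 + (cmod Y1 / cmod P)\<^sup>2) - cmod Y * (cmod F / cmod P)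
    \<le> Re (Y1 * (cnj Y * (- D / P\<^sup>2) + cnj Y1 * inverse P) + (P\<^sup>2 * Y - F) * (cnj Y * inverse P))"
proof -
  define A B E where "A = cmod Y" and "B = cmod Y1 / cmod P" and "E = cmod (D / P)"
  have inv: "inverse P = cnj P / of_real ((cmod P)\<^sup>2)"
    unfolding complex_norm_square using P by (simp add: field_simps)
  have T1: "P\<^sup>2 * Y * (cnj Y * inverse P) = of_real (A\<^sup>2) * P"
    using P unfolding A_def complex_norm_square by (simp add: power2_eq_square)
  have T2: "Y1 * (cnj Y1 * inverse P) = of_real (B\<^sup>2) * cnj P"
  proof -
    have "Y1 * (cnj Y1 * inverse P) = of_real ((cmod Y1)\<^sup>2) * inverse P"
      unfolding complex_norm_square by simp
    also have "\<dots> = of_real (B\<^sup>2) * cnj P"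
      unfolding inv B_def by (simp add: power_divide)
    finally show ?thesis .
  qed
  have "cmod (Y1 * (cnj Y * (- D / P\<^sup>2))) = E * (A * B)"
    using P by (simp add: A_def B_def E_def norm_mult norm_divide norm_power power2_eq_square)
  also have "\<dots> \<le> E * ((A\<^sup>2 + B\<^sup>2) / 2)"
  proof (rule mult_left_mono)
    show "A * B \<le> (A\<^sup>2 + B\<^sup>2) / 2"
      using zero_le_power2[of "A - B"] unfolding power2_diff by simp
  qed (simp add: E_def)
  finally have T3: "- (E * ((A\<^sup>2 + B\<^sup>2) / 2)) \<le> Re (Y1 * (cnj Y * (- D / P\<^sup>2)))"
    using abs_Re_le_cmod[of "Y1 * (cnj Y * (- D / P\<^sup>2))"] by linarith
  have "cmod (F * (cnj Y * inverse P)) = A * (cmod F / cmod P)"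
    by (simp add: A_def norm_mult norm_inverse divide_inverse)
  then have T4: "- (A * (cmod F / cmod P)) \<le> - Re (F * (cnj Y * inverse P))"
    using abs_Re_le_cmod[of "F * (cnj Y * inverse P)"] by linarith
  have "Y1 * (cnj Y * (- D / P\<^sup>2) + cnj Y1 * inverse P) + (P\<^sup>2 * Y - F) * (cnj Y * inverse P)
      = Y1 * (cnj Y * (- D / P\<^sup>2)) + Y1 * (cnj Y1 * inverse P)
        + P\<^sup>2 * Y * (cnj Y * inverse P) - F * (cnj Y * inverse P)"
    by (simp add: algebra_simps)
  also have "Re \<dots> = Re (Y1 * (cnj Y * (- D / P\<^sup>2))) + B\<^sup>2 * Re P + A\<^sup>2 * Re P - Re (F * (cnj Y * inverse P))"
    unfolding T1 T2 by simp
  also have "\<dots> \<ge> (Re P - E / 2) * (A\<^sup>2 + B\<^sup>2) - A * (cmod F / cmod P)"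
    using T3 T4 by (simp add: algebra_simps add_divide_distrib)
  finally show ?thesis by (simp add: A_def B_def E_def)
qed

lemma bounded_linear_of_real_Re: "bounded_linear (\<lambda>z. complex_of_real (Re z))"
  by (rule bounded_linear_compose[OF bounded_linear_of_real bounded_linear_Re])

text \<open>\<open>q_slit\<close> describes the domain on which the principal square root is
  continuous; it follows from the sector condition. \<open>C\<close> is a parameter so that the
  definitions below can mention it.\<close>

locale condition_A_potential =
  fixes q dp :: "real \<Rightarrow> complex" and C :: real
  assumes q_ac: "loc_abs_cont q"
    and q_slit: "\<And>x. 0 \<le> x \<Longrightarrow> q x \<notin> \<real>\<^sub>\<le>\<^sub>0"
    and p_deriv: "AE x in lborel. x \<ge> 0 \<longrightarrow> (psq q has_vector_derivative dp x) (at x)"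
    and C_pos: "C > 0"
    and p_ge: "AE x in lborel. x \<ge> 0 \<longrightarrow> Re (psq q x) \<ge> C + cmod (dp x / psq q x) / 2"
begin

abbreviation "p \<equiv> psq q"

lemma p_square: "(p x)\<^sup>2 = q x"
  by (simp add: psq_def)

lemma q_continuous: "continuous_on {0..} q"
proof (rule continuous_on_atLeastI)
  fix b :: real
  show "continuous_on {0..b} q"
    using q_ac abs_cont_on_continuous[of 0 b q] by (cases "0 \<le> b") (auto simp: loc_abs_cont_def)
qed

lemma p_continuous: "continuous_on {0..} p"
  unfolding psq_def[abs_def]
  by (rule continuous_on_compose2[OF continuous_on_csqrt q_continuous]) (use q_slit in auto)

text \<open>Continuity turns the a.e. bound into one at every point: next to a violation there would
  be a whole interval of violations, which is not negligible.\<close>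

lemma Re_p_ge: assumes "0 \<le> x" shows "C \<le> Re (p x)"
proof (rule ccontr)
  assume "\<not> C \<le> Re (p x)"
  then have lt: "Re (p x) < C" by simp
  have "continuous_on {0..} (\<lambda>x. Re (p x))" using p_continuous by (intro continuous_intros)
  then obtain d where d: "d > 0" "\<And>y. 0 \<le> y \<Longrightarrow> \<bar>y - x\<bar> < d \<Longrightarrow> \<bar>Re (p y) - Re (p x)\<bar> < C - Re (p x)"
    unfolding continuous_on_iff dist_real_def
    using assms lt by (metis atLeast_iff diff_gt_0_iff_gt)
  obtain N where N: "negligible N" "\<And>x. x \<notin> N \<Longrightarrow> x \<ge> 0 \<longrightarrow> Re (p x) \<ge> C + cmod (dp x / p x) / 2"
    using p_ge by (rule negligible_of_AE) blast
  have "{x<..<x+d} \<subseteq> N"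
  proof
    fix y assume y: "y \<in> {x<..<x+d}"
    have "\<bar>Re (p y) - Re (p x)\<bar> < C - Re (p x)" using d(2)[of y] y assms by auto
    then have "Re (p y) < C" by linarith
    then have "\<not> (Re (p y) \<ge> C + cmod (dp y / p y) / 2)"
      using norm_ge_zero[of "dp y / p y"] by linarith
    then show "y \<in> N" using N(2)[of y] y assms by auto
  qed
  then have "negligible {x<..<x+d}" using N(1) negligible_subset by blast
  then show False
    using open_not_negligible[of "{x<..<x+d}"] d(1) by auto
qed

lemma cmod_p_ge: "0 \<le> x \<Longrightarrow> C \<le> cmod (p x)"
  using Re_p_ge complex_Re_le_cmod order_trans by blast

lemma p_nonzero: "0 \<le> x \<Longrightarrow> p x \<noteq> 0"
  using cmod_p_ge C_pos by force

lemma cmod_q: "cmod (q x) = (cmod (p x))\<^sup>2"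
  by (metis p_square norm_power)

lemma cmod_q_ge: "0 \<le> x \<Longrightarrow> C\<^sup>2 \<le> cmod (q x)"
  unfolding cmod_q using cmod_p_ge C_pos by (intro power_mono) auto

lemma cmod_q_pos: "0 \<le> x \<Longrightarrow> 0 < cmod (q x)"
  using p_nonzero by (simp add: cmod_q)

text \<open>In \<open>q t - q s = (p t - p s) * (p t + p s)\<close> the last factor has real part at
  least \<open>2 * C\<close>, so the increments of \<open>p\<close> are controlled by those of
  \<open>q\<close>.\<close>

lemma ac_deriv_p: "ac_deriv_on 0 b p dp"
  unfolding ac_deriv_on_def
proof
  show "abs_cont_on 0 b p"
  proof (cases "0 \<le> b")
    case True
    then have "abs_cont_on 0 b q" using q_ac by (simp add: loc_abs_cont_def)
    then show ?thesis
    proof (rule abs_cont_on_combine[where K = "1 / (2 * C)"])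
      fix s t assume st: "0 \<le> s" "s \<le> t" "t \<le> b"
      have "q t - q s = (p t - p s) * (p t + p s)"
        using p_square[of s] p_square[of t] by (metis power2_eq_square square_diff_square_factored mult.commute)
      moreover have "2 * C \<le> cmod (p t + p s)"
        using Re_p_ge[of s] Re_p_ge[of t] st complex_Re_le_cmod[of "p t + p s"] by simp
      ultimately have "cmod (p t - p s) * (2 * C) \<le> cmod (q t - q s)"
        by (simp add: norm_mult mult_left_mono)
      then have "cmod (p t - p s) \<le> 1 / (2 * C) * cmod (q t - q s)"
        using C_pos by (simp add: field_simps)
      also have "\<dots> \<le> 1 / (2 * C) * (cmod (q t - q s) + cmod (q t - q s))"
        using C_pos by (intro mult_left_mono) auto
      finally show "cmod (p t - p s) \<le> 1 / (2 * C) * (cmod (q t - q s) + cmod (q t - q s))" .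
    qed (use \<open>abs_cont_on 0 b q\<close> C_pos in auto)
  next
    case False
    then show ?thesis by (intro abs_cont_on_lipschitz[where K = 0]) auto
  qed
  show "AE x in lborel. x \<in> {0..b} \<longrightarrow> (p has_vector_derivative dp x) (at x)"
    using p_deriv by eventually_elim auto
qed

lemma rho_ge: "AE x in lborel. x \<ge> 0 \<longrightarrow> C \<le> rho q dp x"
  using p_ge by eventually_elim (auto simp: rho_def)

section \<open>Solutions, their flux and their energy\<close>

definition solution :: "(real \<Rightarrow> complex) \<Rightarrow> (real \<Rightarrow> complex) \<Rightarrow> (real \<Rightarrow> complex) \<Rightarrow> bool" where
  "solution y y1 f \<longleftrightarrow>
     (\<forall>b. ac_deriv_on 0 b y y1 \<and> ac_deriv_on 0 b y1 (\<lambda>x. q x * y x - f x))"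

lemma solves_LU_iff:
  "solves_LU q a0 a1 y y1 f \<longleftrightarrow>
     L2_plus y \<and> L2_plus f \<and> solution y y1 f \<and> a0 * y 0 + a1 * y1 0 = 0"
  unfolding solves_LU_def solution_def all_conj_distrib loc_ac_deriv_iff by blast

lemma solution_add_cmult:
  assumes "solution y y1 f" "solution z z1 g"
  shows "solution (\<lambda>x. y x + c * z x) (\<lambda>x. y1 x + c * z1 x) (\<lambda>x. f x + c * g x)"
proof -
  have lin: "bounded_linear (\<lambda>w. c * w)" by (rule bounded_linear_mult_right)
  have "ac_deriv_on 0 b (\<lambda>x. y x + c * z x) (\<lambda>x. y1 x + c * z1 x)" for b
    using assms unfolding solution_def
    by (intro ac_deriv_on_add ac_deriv_on_linear_image[OF lin]) auto
  moreover have "ac_deriv_on 0 b (\<lambda>x. y1 x + c * z1 x)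
      (\<lambda>x. (q x * y x - f x) + c * (q x * z x - g x))" for b
    using assms unfolding solution_def
    by (intro ac_deriv_on_add ac_deriv_on_linear_image[OF lin]) auto
  ultimately show ?thesis
    unfolding solution_def by (simp add: algebra_simps)
qed

text \<open>What remains of \<open>|y| |f / p|\<close> when Young's inequality charges
  \<open>C / 2 * |y|^2\<close> to the square terms.\<close>

definition source :: "(real \<Rightarrow> complex) \<Rightarrow> real \<Rightarrow> real" where
  "source f x = (cmod (f x))\<^sup>2 / (2 * C * cmod (q x))"

definition energy_density :: "(real \<Rightarrow> complex) \<Rightarrow> (real \<Rightarrow> complex) \<Rightarrow> real \<Rightarrow> real" where
  "energy_density y y1 x = (cmod (y x))\<^sup>2 + (cmod (y1 x))\<^sup>2 / cmod (q x)"

definition flux :: "(real \<Rightarrow> complex) \<Rightarrow> (real \<Rightarrow> complex) \<Rightarrow> real \<Rightarrow> real" where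
  "flux y y1 x = Re (y1 x * cnj (y x) / p x)"

text \<open>Adding the accumulated source to the flux makes the sum nondecreasing.\<close>

definition energy :: "(real \<Rightarrow> complex) \<Rightarrow> (real \<Rightarrow> complex) \<Rightarrow> (real \<Rightarrow> complex) \<Rightarrow> real \<Rightarrow> real" where
  "energy y y1 f x = flux y y1 x + integral {0..x} (source f)"

lemma source_nonneg: "0 \<le> source f x"
  using C_pos by (simp add: source_def)

lemma energy_density_nonneg: "0 \<le> energy_density y y1 x"
  by (simp add: energy_density_def)

lemma weighted_norm_integrable:
  assumes "L2_plus f"
  shows "set_integrable lborel {0..} (\<lambda>x. (cmod (f x))\<^sup>2 / cmod (q x))"
proof (rule set_integrable_bound)
  show "set_integrable lborel {0..} (\<lambda>x. 1 / C\<^sup>2 * (cmod (f x))\<^sup>2)"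
    by (rule set_integrable_mult_right) (rule L2_plus_set_integrable[OF assms])
  have [measurable]: "(\<lambda>x. indicat_real {0..} x *\<^sub>R f x) \<in> borel_measurable borel"
    using assms by (simp add: L2_plus_def set_borel_measurable_def)
  have [measurable]: "(\<lambda>x. indicat_real {0..} x *\<^sub>R q x) \<in> borel_measurable borel"
    by (rule borel_measurable_continuous_on_indicator[OF _ q_continuous]) simp
  have "(\<lambda>x. (cmod (indicat_real {0..} x *\<^sub>R f x))\<^sup>2 / cmod (indicat_real {0..} x *\<^sub>R q x)) \<in> borel_measurable borel"
    by measurable
  also have "(\<lambda>x. (cmod (indicat_real {0..} x *\<^sub>R f x))\<^sup>2 / cmod (indicat_real {0..} x *\<^sub>R q x))
      = (\<lambda>x. indicat_real {0..} x *\<^sub>R ((cmod (f x))\<^sup>2 / cmod (q x)))"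
    by (auto simp: indicator_def)
  finally show "set_borel_measurable lborel {0..} (\<lambda>x. (cmod (f x))\<^sup>2 / cmod (q x))"
    by (simp add: set_borel_measurable_def)
  have "(cmod (f x))\<^sup>2 / cmod (q x) \<le> 1 / C\<^sup>2 * (cmod (f x))\<^sup>2" if "0 \<le> x" for x
  proof -
    have "(cmod (f x))\<^sup>2 / cmod (q x) \<le> (cmod (f x))\<^sup>2 / C\<^sup>2"
      using cmod_q_ge[OF that] cmod_q_pos[OF that] C_pos
      by (intro divide_left_mono mult_pos_pos zero_less_power) auto
    then show ?thesis by simp
  qed
  then show "AE x in lborel. x \<in> {0..} \<longrightarrow>
      norm ((cmod (f x))\<^sup>2 / cmod (q x)) \<le> norm (1 / C\<^sup>2 * (cmod (f x))\<^sup>2)"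
    by (intro AE_I2) simp
qed

lemma source_eq: "source f x = 1 / (2 * C) * ((cmod (f x))\<^sup>2 / cmod (q x))"
  by (simp add: source_def)

lemma source_integrable:
  assumes "L2_plus f" shows "set_integrable lborel {0..} (source f)"
  unfolding source_eq[abs_def]
  by (rule set_integrable_mult_right) (rule weighted_norm_integrable[OF assms])

text \<open>Half of \<open>rho * energy_density\<close> absorbs the cross term between
  \<open>y\<close> and \<open>f\<close>, the other half survives. Later arguments use
  \<open>k\<close> only through this lower bound; \<open>C \<le> rho\<close> is included so that one
  a.e. statement carries both facts.\<close>

lemma energy_ac_deriv:
  assumes sol: "solution y y1 f" and f: "L2_plus f"
  obtains k where "\<And>b. ac_deriv_on 0 b (\<lambda>x. of_real (energy y y1 f x)) (\<lambda>x. of_real (k x))"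
    "AE x in lborel. x \<ge> 0 \<longrightarrow> C \<le> rho q dp x \<and> rho q dp x * energy_density y y1 x \<le> 2 * k x"
proof -
  define k0 where "k0 x = y1 x * (cnj (y x) * (- dp x / (p x)\<^sup>2) + cnj (y1 x) * inverse (p x))
      + (q x * y x - f x) * (cnj (y x) * inverse (p x))" for x
  define k where "k x = Re (k0 x) + source f x" for x
  have cl: "bounded_linear cnj" by (rule bounded_linear_cnj)
  show thesis
  proof
    fix b :: real
    have "ac_deriv_on 0 b (\<lambda>x. y1 x * (cnj (y x) * inverse (p x))) k0"
      unfolding k0_def
      using sol by (intro ac_deriv_on_mult ac_deriv_on_linear_image[OF cl]
        ac_deriv_on_inverse[OF ac_deriv_p C_pos]) (auto simp: solution_def cmod_p_ge)
    from ac_deriv_on_add[OF ac_deriv_on_linear_image[OF bounded_linear_of_real_Re this]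
        ac_deriv_on_primitive(1)[OF source_integrable[OF f] source_nonneg]]
    show "ac_deriv_on 0 b (\<lambda>x. of_real (energy y y1 f x)) (\<lambda>x. of_real (k x))"
      by (simp add: energy_def flux_def k_def divide_inverse mult.assoc)
  next
    have "rho q dp x * energy_density y y1 x \<le> 2 * k x" if x: "0 \<le> x" "C \<le> rho q dp x" for x
    proof -
      define A F where "A = cmod (y x)" and "F = cmod (f x) / cmod (p x)"
      have den: "energy_density y y1 x = (cmod (y x))\<^sup>2 + (cmod (y1 x) / cmod (p x))\<^sup>2"
        by (simp add: energy_density_def cmod_q power_divide)
      have k0: "rho q dp x * energy_density y y1 x - A * F \<le> Re (k0 x)"
        using Re_energy_derivative_ge[OF p_nonzero[OF x(1)], of "dp x" "y x" "y1 x" "f x"]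
        by (simp add: k0_def p_square den rho_def A_def F_def)
      have src: "source f x = F\<^sup>2 / (2 * C)"
        by (simp add: source_def F_def cmod_q power_divide)
      have "2 * (A * F) \<le> C * A\<^sup>2 + F\<^sup>2 / C"
      proof -
        have "0 \<le> (C * A - F)\<^sup>2 / C" using C_pos by simp
        also have "(C * A - F)\<^sup>2 / C = C * A\<^sup>2 - 2 * (A * F) + F\<^sup>2 / C"
          using C_pos by (simp add: power2_eq_square field_simps)
        finally show ?thesis by simp
      qed
      moreover have "C * A\<^sup>2 \<le> rho q dp x * energy_density y y1 x"
        using x(2) C_pos by (intro mult_mono) (auto simp: A_def energy_density_def)
      ultimately show ?thesis using k0 unfolding k_def src by simp
    qed
    then show "AE x in lborel. x \<ge> 0 \<longrightarrow> C \<le> rho q dp x \<and> rho q dp x * energy_density y y1 x \<le> 2 * k x"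
      using rho_ge by (auto elim: eventually_mono)
  qed
qed

lemma
  assumes sol: "solution y y1 f" and f: "L2_plus f" and ab: "0 \<le> a" "a \<le> b"
  shows energy_bound: "(\<integral>\<^sup>+x\<in>{a..b}. ennreal (rho q dp x * energy_density y y1 x) \<partial>lborel)
        \<le> ennreal (2 * (energy y y1 f b - energy y y1 f a))"
    and energy_mono: "energy y y1 f a \<le> energy y y1 f b"
proof -
  obtain k where k: "\<And>b. ac_deriv_on 0 b (\<lambda>x. of_real (energy y y1 f x)) (\<lambda>x. of_real (k x))"
    "AE x in lborel. x \<ge> 0 \<longrightarrow> C \<le> rho q dp x \<and> rho q dp x * energy_density y y1 x \<le> 2 * k x"
    using energy_ac_deriv[OF sol f] by blast
  have E: "ac_deriv_on a b (\<lambda>x. of_real (energy y y1 f x)) (\<lambda>x. of_real (k x))"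
    using ac_deriv_on_subset[OF k(1)[of b] ab(1)] by simp
  have nn: "AE x in lborel. x \<in> {a..b} \<longrightarrow> 0 \<le> k x \<and> rho q dp x * energy_density y y1 x \<le> 2 * k x"
    using k(2)
  proof eventually_elim
    case (elim x)
    have "0 \<le> rho q dp x * energy_density y y1 x" if "C \<le> rho q dp x"
      using that C_pos energy_density_nonneg by (intro mult_nonneg_nonneg) auto
    then show ?case using elim ab by force
  qed
  have "AE x in lborel. x \<in> {a..b} \<longrightarrow> 0 \<le> Re (of_real (k x))"
    using nn by eventually_elim simp
  from ac_deriv_on_mono[OF E ab(2) this] show "energy y y1 f a \<le> energy y y1 f b" by simp
  show "(\<integral>\<^sup>+x\<in>{a..b}. ennreal (rho q dp x * energy_density y y1 x) \<partial>lborel)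
        \<le> ennreal (2 * (energy y y1 f b - energy y y1 f a))"
  proof -
    have "AE x in lborel. x \<in> {a..b} \<longrightarrow> 0 \<le> Re (of_real (k x) + of_real (k x)) \<and>
        rho q dp x * energy_density y y1 x \<le> Re (of_real (k x) + of_real (k x))"
      using nn by eventually_elim simp
    from nn_integral_le_ac_deriv[OF ac_deriv_on_add[OF E E] ab(2) this] show ?thesis by simp
  qed
qed

definition total_source :: "(real \<Rightarrow> complex) \<Rightarrow> real" where
  "total_source f = (LINT x:{0..}|lborel. source f x)"

lemma source_primitive_le: "L2_plus f \<Longrightarrow> integral {0..x} (source f) \<le> total_source f"
  unfolding total_source_def by (rule ac_deriv_on_primitive(3)[OF source_integrable source_nonneg])

lemma source_primitive_nonneg: "L2_plus f \<Longrightarrow> 0 \<le> integral {0..x} (source f)"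
  by (rule ac_deriv_on_primitive(2)[OF source_integrable source_nonneg])

lemma total_nonneg: "L2_plus f \<Longrightarrow> 0 \<le> total_source f"
  using source_primitive_le source_primitive_nonneg order_trans by blast

lemma flux_le: "flux y y1 x \<le> cmod (y x) * (cmod (y1 x) / cmod (p x))"
  using complex_Re_le_cmod[of "y1 x * cnj (y x) / p x"]
  by (simp add: flux_def norm_mult norm_divide mult.commute)

lemma energy_0: "energy y y1 f 0 = flux y y1 0"
  by (simp add: energy_def)

section \<open>Square-integrable solutions\<close>

text \<open>If the excess \<open>\<psi> = energy - total_source\<close> were positive somewhere, then \<open>\<psi>' \<ge> C/2 (|y|\<^sup>2 + |y'/p|\<^sup>2)\<close> and
  \<open>|y| |y'/p| \<ge> \<psi>\<close> would give \<open>\<psi>'/\<psi>\<^sup>2 + C/2 |y|\<^sup>2 \<ge> C\<close> from there on, although the left hand side is integrable.\<close>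
lemma energy_le_total:
  assumes sol: "solution y y1 f" and f: "L2_plus f" and y: "L2_plus y" and x0: "0 \<le> x0"
  shows "energy y y1 f x0 \<le> total_source f"
proof (rule ccontr)
  assume neg: "\<not> ?thesis"
  define \<psi> where "\<psi> t = energy y y1 f t - total_source f" for t
  define \<delta> where "\<delta> = \<psi> x0"
  have \<delta>: "\<delta> > 0" using neg by (simp add: \<delta>_def \<psi>_def)
  have \<psi>_ge: "\<delta> \<le> \<psi> t" if "x0 \<le> t" for t
    using energy_mono[OF sol f x0 that] by (simp add: \<delta>_def \<psi>_def)
  have \<psi>_le: "\<psi> t \<le> cmod (y t) * (cmod (y1 t) / cmod (p t))" for t
    using flux_le[of y y1 t] source_primitive_le[OF f, of t] by (simp add: \<psi>_def energy_def)
  obtain k where k: "\<And>b. ac_deriv_on 0 b (\<lambda>x. of_real (energy y y1 f x)) (\<lambda>x. of_real (k x))"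
    "AE x in lborel. x \<ge> 0 \<longrightarrow> C \<le> rho q dp x \<and> rho q dp x * energy_density y y1 x \<le> 2 * k x"
    using energy_ac_deriv[OF sol f] by blast
  define Y where "Y t = integral {0..t} (\<lambda>x. (cmod (y x))\<^sup>2)" for t
  define B where "B = (LINT x:{0..}|lborel. (cmod (y x))\<^sup>2)"
  have Y: "ac_deriv_on 0 b (\<lambda>x. of_real (Y x)) (\<lambda>x. of_real ((cmod (y x))\<^sup>2))" "0 \<le> Y t" "Y t \<le> B" for b t
    unfolding Y_def B_def by (rule ac_deriv_on_primitive[OF L2_plus_set_integrable[OF y]]; simp)+
  \<comment> \<open>Monotonicity of \<open>H\<close> below forces
    \<open>C * (x1 - x0) \<le> 1 / \<delta> + C / 2 * B\<close>; this point lies beyond that range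
    by one.\<close>
  define x1 where "x1 = x0 + (1 / \<delta> + C / 2 * B) / C + 1"
  have B: "0 \<le> B" using Y(2,3) order_trans by blast
  have x01: "x0 \<le> x1" using \<delta> C_pos B by (simp add: x1_def)
  have "ac_deriv_on x0 x1 (\<lambda>t. of_real (energy y y1 f t) + of_real (- total_source f)) (\<lambda>t. of_real (k t) + 0)"
    by (intro ac_deriv_on_add ac_deriv_on_const ac_deriv_on_subset[OF k(1) x0 order_refl])
  then have "ac_deriv_on x0 x1 (\<lambda>t. of_real (\<psi> t)) (\<lambda>t. of_real (k t))"
    by (simp add: \<psi>_def)
  then have 1: "ac_deriv_on x0 x1 (\<lambda>t. inverse (of_real (\<psi> t))) (\<lambda>t. - of_real (k t) / (of_real (\<psi> t))\<^sup>2)"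
    using \<psi>_ge \<delta> by (intro ac_deriv_on_inverse[where \<delta> = \<delta>]) (auto intro: order_trans[OF _ abs_ge_self])
  have 2: "ac_deriv_on x0 x1 (\<lambda>x. of_real (Y x)) (\<lambda>x. of_real ((cmod (y x))\<^sup>2))"
    by (rule ac_deriv_on_subset[OF Y(1) x0 order_refl])
  have 3: "ac_deriv_on x0 x1 (\<lambda>t. complex_of_real (- C * t)) (\<lambda>_. of_real (- C))"
    by (rule ac_deriv_on_C1, rule has_vector_derivative_of_real)
      (auto intro!: derivative_eq_intros simp flip: has_real_derivative_iff_has_vector_derivative)
  \<comment> \<open>\<open>-1 / \<psi>\<close> has derivative \<open>\<psi>' / \<psi>^2\<close>, so
    \<open>H\<close> is a primitive of the left minus the right side of the inequality to be
    contradicted.\<close>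
  define H where "H t = - 1 * inverse (of_real (\<psi> t)) + (of_real (C / 2) * of_real (Y t) + complex_of_real (- C * t))" for t
  have H: "ac_deriv_on x0 x1 H
      (\<lambda>t. - 1 * (- of_real (k t) / (of_real (\<psi> t))\<^sup>2) + (of_real (C / 2) * of_real ((cmod (y t))\<^sup>2) + of_real (- C)))"
    unfolding H_def
    by (intro ac_deriv_on_add ac_deriv_on_linear_image[OF bounded_linear_mult_right] 1 2 3)
  have ReH: "Re (H t) = - 1 / \<psi> t + C / 2 * Y t - C * t" for t
  proof -
    have "H t = of_real (- 1 / \<psi> t + C / 2 * Y t - C * t)"
      by (simp add: H_def inverse_eq_divide)
    then show ?thesis by (simp only: Re_complex_of_real)
  qed
  have "0 \<le> k t / (\<psi> t)\<^sup>2 + C / 2 * (cmod (y t))\<^sup>2 - C"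
    if t: "x0 \<le> t" "C \<le> rho q dp t" "rho q dp t * energy_density y y1 t \<le> 2 * k t" for t
  proof -
    \<comment> \<open>\<open>\<beta>\<close> is \<open>|y'/p|\<close> in units of
      \<open>\<psi>\<close>. The product bound then reads \<open>1 \<le> A * \<beta>\<close>, which
      gives \<open>2 \<le> A\<^sup>2 + \<beta>\<^sup>2\<close>.\<close>
    define A \<beta> where "A = cmod (y t)" and "\<beta> = cmod (y1 t) / cmod (p t) / \<psi> t"
    have \<psi>: "0 < \<psi> t" using \<psi>_ge[OF t(1)] \<delta> by simp
    have den: "energy_density y y1 t = A\<^sup>2 + (\<psi> t * \<beta>)\<^sup>2"
      using \<psi> by (simp add: energy_density_def cmod_q power_divide A_def \<beta>_def)
    have "C * (\<psi> t * \<beta>)\<^sup>2 \<le> rho q dp t * energy_density y y1 t"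
      using t(2) C_pos unfolding den by (intro mult_mono) auto
    then have "C * \<beta>\<^sup>2 * (\<psi> t)\<^sup>2 \<le> 2 * k t"
      using t(3) by (simp add: power_mult_distrib mult_ac)
    then have "C * \<beta>\<^sup>2 / 2 \<le> k t / (\<psi> t)\<^sup>2"
      using \<psi> by (simp add: field_simps)
    moreover have "A * \<beta> = cmod (y t) * (cmod (y1 t) / cmod (p t)) / \<psi> t"
      by (simp add: A_def \<beta>_def)
    then have "1 \<le> A * \<beta>"
      using \<psi>_le[of t] \<psi> by (simp only: le_divide_eq_1_pos)
    then have "C * 2 \<le> C * (\<beta>\<^sup>2 + A\<^sup>2)"
      using zero_le_power2[of "A - \<beta>"] C_pos unfolding power2_diff by (intro mult_left_mono) auto
    ultimately show ?thesis unfolding A_def[symmetric] distrib_left by linarith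
  qed
  moreover have "- 1 * (- of_real (k t) / (of_real (\<psi> t))\<^sup>2) + (of_real (C / 2) * of_real ((cmod (y t))\<^sup>2) + of_real (- C))
      = complex_of_real (k t / (\<psi> t)\<^sup>2 + C / 2 * (cmod (y t))\<^sup>2 - C)" for t
    by simp
  ultimately have "AE t in lborel. t \<in> {x0..x1} \<longrightarrow> 0 \<le> Re (- 1 * (- of_real (k t) / (of_real (\<psi> t))\<^sup>2)
      + (of_real (C / 2) * of_real ((cmod (y t))\<^sup>2) + of_real (- C)))"
    using k(2) x0 by (simp only: Re_complex_of_real) (auto elim!: eventually_mono)
  from ac_deriv_on_mono[OF H x01 this]
  have "- 1 / \<delta> + C / 2 * Y x0 - C * x0 \<le> - 1 / \<psi> x1 + C / 2 * Y x1 - C * x1"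
    unfolding ReH \<delta>_def .
  moreover have "0 < 1 / \<psi> x1" using \<psi>_ge[OF x01] \<delta> by simp
  moreover have "C / 2 * Y x1 \<le> C / 2 * B" "0 \<le> C / 2 * Y x0"
    using Y(2,3) C_pos by (auto intro!: mult_left_mono)
  moreover have "C * x1 = C * x0 + 1 / \<delta> + C / 2 * B + C"
    using C_pos by (simp add: x1_def field_simps)
  ultimately show False using C_pos by simp
qed

text \<open>Integrates the derivative of \<open>(1 - t) |y'(t)|\<^sup>2\<close> over the unit interval.\<close>
lemma initial_slope_bound:
  obtains K where "K > 0" "\<And>y y1 f. solution y y1 f \<Longrightarrow> L2_plus f \<Longrightarrow> energy y y1 f 1 \<le> total_source f \<Longrightarrow>
    (cmod (y1 0))\<^sup>2 \<le> K * (2 * total_source f - flux y y1 0)"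
proof -
  have "compact (q ` {0..1})"
    by (rule compact_continuous_image[OF continuous_on_subset[OF q_continuous]]) auto
  then obtain M where M: "M > 0" "\<And>x. 0 \<le> x \<Longrightarrow> x \<le> 1 \<Longrightarrow> cmod (q x) \<le> M"
    using compact_imp_bounded[of "q ` {0..1}"] unfolding bounded_pos by auto
  \<comment> \<open>With \<open>A\<close>, \<open>B\<close>, \<open>F\<close> the moduli of
    \<open>y\<close>, \<open>y'\<close>, \<open>f\<close>: \<open>K1 * k\<close> has to cover
    \<open>2 * B\<^sup>2 + 2 * M\<^sup>2 * A\<^sup>2\<close> and \<open>K2 * source f\<close> has to
    cover \<open>2 * F\<^sup>2\<close>.\<close>
  define K1 K2 where "K1 = 4 * (M + M\<^sup>2) / C" and "K2 = 4 * C * M"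
  have K12: "0 < K1" "0 < K2" using M(1) C_pos by (auto simp: K1_def K2_def add_pos_pos)
  \<comment> \<open>One constant serves all solutions and all right-hand sides; both the compactness
    argument and the final bound rest on this uniformity.\<close>
  show thesis
  proof (rule that[of "max K1 K2"])
    show "0 < max K1 K2" using K12 by simp
    fix y y1 f assume sol: "solution y y1 f" and f: "L2_plus f" and E1: "energy y y1 f 1 \<le> total_source f"
    obtain k where k: "\<And>b. ac_deriv_on 0 b (\<lambda>x. of_real (energy y y1 f x)) (\<lambda>x. of_real (k x))"
      "AE x in lborel. x \<ge> 0 \<longrightarrow> C \<le> rho q dp x \<and> rho q dp x * energy_density y y1 x \<le> 2 * k x"
      using energy_ac_deriv[OF sol f] by blast
    define S where "S t = integral {0..t} (source f)" for t
    have S: "ac_deriv_on 0 1 (\<lambda>t. of_real (S t)) (\<lambda>t. of_real (source f t))"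
      unfolding S_def by (rule ac_deriv_on_primitive(1)[OF source_integrable[OF f] source_nonneg])
    define k1 where "k1 t = q t * y t - f t" for t
    have y1: "ac_deriv_on 0 1 y1 k1" using sol by (simp add: solution_def k1_def[abs_def])
    have lin: "ac_deriv_on 0 1 (\<lambda>t. complex_of_real (1 - t)) (\<lambda>_. of_real (- 1))"
      by (rule ac_deriv_on_C1, rule has_vector_derivative_of_real)
        (auto intro!: derivative_eq_intros simp flip: has_real_derivative_iff_has_vector_derivative)
    \<comment> \<open>The first summand is \<open>|y' 0|^2\<close> at \<open>0\<close> and vanishes
      at \<open>1\<close>; energy and source are added so that \<open>H\<close> is
      nondecreasing.\<close>
    define H where "H t = complex_of_real (1 - t) * (y1 t * cnj (y1 t))
        + (of_real K1 * of_real (energy y y1 f t) + of_real K2 * of_real (S t))" for t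
    define h where "h t = (complex_of_real (1 - t) * (y1 t * cnj (k1 t) + k1 t * cnj (y1 t))
        + of_real (- 1) * (y1 t * cnj (y1 t))) + (of_real K1 * of_real (k t) + of_real K2 * of_real (source f t))" for t
    have H: "ac_deriv_on 0 1 H h"
      unfolding H_def h_def
      by (intro ac_deriv_on_add ac_deriv_on_mult lin y1 ac_deriv_on_linear_image[OF bounded_linear_cnj]
          ac_deriv_on_linear_image[OF bounded_linear_mult_right] k(1) S)
    have "0 \<le> Re (h t)" if t: "0 \<le> t" "t \<le> 1" "C \<le> rho q dp t"
      "rho q dp t * energy_density y y1 t \<le> 2 * k t" for t
    proof -
      define A B F Q where "A = cmod (y t)" and "B = cmod (y1 t)" and "F = cmod (f t)" and "Q = cmod (q t)"
      have Q: "0 < Q" "Q \<le> M" using cmod_q_pos M(2) t by (auto simp: Q_def)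
      have "cmod (k1 t) \<le> Q * A + F"
        unfolding k1_def Q_def A_def F_def by (metis norm_mult norm_triangle_ineq4)
      then have "(cmod (k1 t))\<^sup>2 \<le> (Q * A + F)\<^sup>2" by (intro power_mono) auto
      also have "\<dots> \<le> 2 * (Q * A)\<^sup>2 + 2 * F\<^sup>2"
        using zero_le_power2[of "Q * A - F"] unfolding power2_diff power2_sum by linarith
      also have "(Q * A)\<^sup>2 \<le> (M * A)\<^sup>2"
        using Q by (intro power_mono mult_right_mono) (auto simp: A_def)
      finally have k1: "(cmod (k1 t))\<^sup>2 \<le> 2 * (M\<^sup>2 * A\<^sup>2) + 2 * F\<^sup>2"
        by (simp add: power_mult_distrib)
      have "Re (y1 t * cnj (k1 t) + k1 t * cnj (y1 t)) = 2 * Re (y1 t * cnj (k1 t))"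
        by (simp add: algebra_simps)
      moreover have "\<bar>Re (y1 t * cnj (k1 t))\<bar> \<le> B * cmod (k1 t)"
        using abs_Re_le_cmod[of "y1 t * cnj (k1 t)"] by (simp add: norm_mult B_def)
      ultimately have "\<bar>Re (y1 t * cnj (k1 t) + k1 t * cnj (y1 t))\<bar> \<le> 2 * B * cmod (k1 t)" by linarith
      also have "\<dots> \<le> B\<^sup>2 + (cmod (k1 t))\<^sup>2"
        using zero_le_power2[of "B - cmod (k1 t)"] unfolding power2_diff by linarith
      finally have "(1 - t) * \<bar>Re (y1 t * cnj (k1 t) + k1 t * cnj (y1 t))\<bar> \<le> 1 * (B\<^sup>2 + (cmod (k1 t))\<^sup>2)"
        using t by (intro mult_mono) auto
      moreover have "\<bar>Re (complex_of_real r * z)\<bar> = r * \<bar>Re z\<bar>" if "0 \<le> r" for r z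
        using that by (simp add: abs_mult)
      ultimately have "\<bar>Re (complex_of_real (1 - t) * (y1 t * cnj (k1 t) + k1 t * cnj (y1 t)))\<bar>
          \<le> B\<^sup>2 + (cmod (k1 t))\<^sup>2"
        using t by (simp only: mult_1 diff_ge_0_iff_ge)
      from abs_le_D2[OF this] have 1: "- (B\<^sup>2 + (cmod (k1 t))\<^sup>2)
          \<le> Re (complex_of_real (1 - t) * (y1 t * cnj (k1 t) + k1 t * cnj (y1 t)))"
        by (simp only: minus_le_iff)
      have BB: "Re (of_real (- 1) * (y1 t * cnj (y1 t))) = - B\<^sup>2"
        unfolding B_def complex_norm_square[symmetric] by simp
      have "C * (A\<^sup>2 + B\<^sup>2 / Q) \<le> rho q dp t * energy_density y y1 t"
        unfolding energy_density_def A_def B_def Q_def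
        using t(3) C_pos by (intro mult_right_mono) auto
      then have "C * (A\<^sup>2 + B\<^sup>2 / Q) \<le> 2 * k t" using t(4) by linarith
      moreover have "B\<^sup>2 / M \<le> B\<^sup>2 / Q" using Q by (intro divide_left_mono) auto
      then have "C * (A\<^sup>2 + B\<^sup>2 / M) \<le> C * (A\<^sup>2 + B\<^sup>2 / Q)" using C_pos by simp
      ultimately have "C * (A\<^sup>2 + B\<^sup>2 / M) \<le> 2 * k t" by (rule order_trans[rotated])
      then have "C * (A\<^sup>2 + B\<^sup>2 / M) / 2 \<le> k t" by simp
      then have "K1 * (C * (A\<^sup>2 + B\<^sup>2 / M) / 2) \<le> K1 * k t" using K12 by (intro mult_left_mono) auto
      moreover have "K1 * (C * (A\<^sup>2 + B\<^sup>2 / M) / 2) = 2 * B\<^sup>2 + 2 * M\<^sup>2 * A\<^sup>2 + 2 * M * A\<^sup>2 + 2 * M * B\<^sup>2"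
        using C_pos M(1) unfolding K1_def by (simp add: field_simps power2_eq_square)
      moreover have "0 \<le> 2 * M * A\<^sup>2" "0 \<le> 2 * M * B\<^sup>2" using M(1) by auto
      ultimately have 2: "2 * B\<^sup>2 + 2 * M\<^sup>2 * A\<^sup>2 \<le> K1 * k t" by linarith
      have 3: "2 * F\<^sup>2 \<le> K2 * source f t"
      proof -
        have "2 * F\<^sup>2 * Q \<le> 2 * F\<^sup>2 * M" using Q by (intro mult_left_mono) auto
        then show ?thesis
          using Q C_pos by (simp add: K2_def source_def F_def[symmetric] Q_def[symmetric] field_simps)
      qed
      have "Re (h t) = Re (complex_of_real (1 - t) * (y1 t * cnj (k1 t) + k1 t * cnj (y1 t)))
          + Re (of_real (- 1) * (y1 t * cnj (y1 t))) + (K1 * k t + K2 * source f t)"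
        unfolding h_def by (simp flip: of_real_mult)
      then show ?thesis using 1 2 3 k1 BB by linarith
    qed
    then have "AE t in lborel. t \<in> {0..1} \<longrightarrow> 0 \<le> Re (h t)"
      using k(2) by (auto elim!: eventually_mono)
    from ac_deriv_on_mono[OF H _ this]
    have "(cmod (y1 0))\<^sup>2 \<le> K1 * (energy y y1 f 1 - energy y y1 f 0) + K2 * S 1"
      unfolding H_def complex_norm_square[symmetric]
      by (simp add: S_def algebra_simps flip: of_real_mult)
    also have "\<dots> \<le> max K1 K2 * (energy y y1 f 1 - energy y y1 f 0) + max K1 K2 * S 1"
      using energy_mono[OF sol f, of 0 1] source_primitive_nonneg[OF f, of 1]
      by (intro add_mono mult_right_mono) (auto simp: S_def)
    also have "\<dots> = max K1 K2 * (energy y y1 f 1 + S 1 - flux y y1 0)"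
      by (simp add: energy_0 algebra_simps)
    also have "\<dots> \<le> max K1 K2 * (2 * total_source f - flux y y1 0)"
      using E1 source_primitive_le[OF f, of 1] K12 by (intro mult_left_mono) (auto simp: S_def)
    finally show "(cmod (y1 0))\<^sup>2 \<le> max K1 K2 * (2 * total_source f - flux y y1 0)" .
  qed
qed

section \<open>Existence of solutions, first by initial values, then in the space of
  square-integrable functions\<close>

lemma cauchy_exists:
  assumes f: "L2_plus f"
  obtains y y1 where "solution y y1 f" "y 0 = \<alpha>" "y1 0 = \<beta>"
proof -
  define F where "F x = integral {0..x} f" for x
  have acF: "ac_deriv_on 0 b F f" for b
    unfolding F_def by (rule ac_deriv_on_indefinite_integral[OF L2_plus_locally_integrable[OF f]])
  have F_cont: "continuous_on {0..} F"
    by (rule continuous_on_atLeastI[OF ac_deriv_on_continuous[OF acF]])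
  \<comment> \<open>As \<open>f\<close> need not be continuous, the unknowns are \<open>y\<close>
    and \<open>w = y' + F\<close> with \<open>F\<close> the primitive of \<open>f\<close>. The
    system \<open>y' = w - F\<close>, \<open>w' = q * y\<close> has continuous coefficients.\<close>
  define G where "G t u = (snd u - F t, q t * fst u)" for t and u :: "complex \<times> complex"
  define \<mu> where "\<mu> t = 1 + cmod (q t) + cmod (F t)" for t
  obtain Y where Y: "continuous_on {0..} Y"
    "\<And>x. 0 \<le> x \<Longrightarrow> Y x = (\<alpha>, \<beta>) + integral {0..x} (\<lambda>t. G t (Y t))"
  proof (rule lipschitz_ode_exists)
    show "continuous_on {0..} \<mu>" unfolding \<mu>_def using q_continuous F_cont by (intro continuous_intros)
    fix t :: real and u v :: "complex \<times> complex" assume "0 \<le> t"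
    show "norm (G t 0) \<le> \<mu> t" by (simp add: G_def \<mu>_def norm_Pair)
    have "norm (G t u - G t v) = norm (snd (u - v), q t * fst (u - v))"
      by (simp add: G_def algebra_simps)
    also have "\<dots> \<le> cmod (snd (u - v)) + cmod (q t) * cmod (fst (u - v))"
      using norm_Pair_le[of "snd (u - v)" "q t * fst (u - v)"] by (simp add: norm_mult)
    also have "\<dots> \<le> norm (u - v) + cmod (q t) * norm (u - v)"
      using norm_fst_le[of "fst (u - v)" "snd (u - v)"] norm_snd_le[of "snd (u - v)" "fst (u - v)"]
      by (intro add_mono mult_left_mono) (simp_all only: prod.collapse norm_ge_zero)
    also have "\<dots> \<le> \<mu> t * norm (u - v)"
      by (simp add: \<mu>_def distrib_right)
    finally show "norm (G t u - G t v) \<le> \<mu> t * norm (u - v)" .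
  next
    fix U :: "real \<Rightarrow> complex \<times> complex" assume "continuous_on {0..} U"
    then show "continuous_on {0..} (\<lambda>t. G t (U t))"
      unfolding G_def using q_continuous F_cont by (intro continuous_intros)
  qed blast
  define y w where "y x = fst (Y x)" and "w x = snd (Y x)" for x
  have G_cont: "continuous_on {0..} (\<lambda>t. G t (Y t))"
    unfolding G_def using Y(1) q_continuous F_cont by (intro continuous_intros)
  have Y': "(Y has_vector_derivative G x (Y x)) (at x within {0..b})" if "x \<in> {0..b}" for x b
  proof -
    have "((\<lambda>x. (\<alpha>, \<beta>) + integral {0..x} (\<lambda>t. G t (Y t))) has_vector_derivative 0 + G x (Y x)) (at x within {0..b})"
      by (intro has_vector_derivative_add has_vector_derivative_const
          integral_has_vector_derivative[OF continuous_on_subset[OF G_cont]]) (use that in auto)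
    then show ?thesis
      using that Y(2) by (auto intro: has_vector_derivative_transform[rotated 2])
  qed
  have "ac_deriv_on 0 b y (\<lambda>x. w x - F x)" for b
  proof (rule ac_deriv_on_C1)
    show "(y has_vector_derivative w x - F x) (at x within {0..b})" if "x \<in> {0..b}" for x
      using bounded_linear.has_vector_derivative[OF bounded_linear_fst Y'[OF that]]
      by (simp add: y_def[abs_def] w_def G_def)
    show "continuous_on {0..b} (\<lambda>x. w x - F x)"
      unfolding w_def by (intro continuous_intros continuous_on_subset[OF Y(1)] continuous_on_subset[OF F_cont]) auto
  qed
  moreover have "ac_deriv_on 0 b w (\<lambda>x. q x * y x)" for b
  proof (rule ac_deriv_on_C1)
    show "(w has_vector_derivative q x * y x) (at x within {0..b})" if "x \<in> {0..b}" for x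
      using bounded_linear.has_vector_derivative[OF bounded_linear_snd Y'[OF that]]
      by (simp add: y_def w_def[abs_def] G_def)
    show "continuous_on {0..b} (\<lambda>x. q x * y x)"
      unfolding y_def by (intro continuous_intros continuous_on_subset[OF Y(1)] continuous_on_subset[OF q_continuous]) auto
  qed
  from ac_deriv_on_add[OF this ac_deriv_on_linear_image[OF bounded_linear_mult_right[of "- 1"] acF]]
  have "ac_deriv_on 0 b (\<lambda>x. w x - F x) (\<lambda>x. q x * y x - f x)" for b by simp
  ultimately have "solution y (\<lambda>x. w x - F x) f" by (simp add: solution_def)
  moreover have "y 0 = \<alpha>" "w 0 - F 0 = \<beta>" using Y(2)[of 0] by (simp_all add: y_def w_def F_def)
  ultimately show thesis by (rule that)
qed

lemma solution_measurable:
  assumes "solution y y1 f"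
  shows "set_borel_measurable lborel {0..} y"
proof -
  have "continuous_on {0..} y"
    using assms by (intro continuous_on_atLeastI) (auto simp: solution_def intro: ac_deriv_on_continuous)
  then have "(\<lambda>x. indicat_real {0..} x *\<^sub>R y x) \<in> borel_measurable borel"
    by (intro borel_measurable_continuous_on_indicator) auto
  then show ?thesis by (simp add: set_borel_measurable_def)
qed

lemma source_zero: "source (\<lambda>_. 0) = (\<lambda>_. 0)"
  by (simp add: source_def fun_eq_iff)

text \<open>A zero at \<open>b\<close> would make the energy at \<open>1\<close> nonpositive; as
  \<open>y 0 = 0\<close> also kills the flux at \<open>0\<close>, the slope bound would force
  \<open>y1 0 = 0\<close>. The result permits solving for a prescribed zero at a far
  endpoint.\<close>

lemma solution_nonvanishing:
  assumes sol: "solution y y1 (\<lambda>_. 0)" and "y 0 = 0" "y1 0 = 1" and b: "1 \<le> b"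
  shows "y b \<noteq> 0"
proof
  assume "y b = 0"
  obtain K where K: "K > 0" "\<And>y y1 f. solution y y1 f \<Longrightarrow> L2_plus f \<Longrightarrow> energy y y1 f 1 \<le> total_source f \<Longrightarrow>
    (cmod (y1 0))\<^sup>2 \<le> K * (2 * total_source f - flux y y1 0)"
    using initial_slope_bound by blast
  have "energy y y1 (\<lambda>_. 0) 1 \<le> energy y y1 (\<lambda>_. 0) b"
    using energy_mono[OF sol L2_plus_zero, of 1 b] b by simp
  also have "\<dots> = 0" using \<open>y b = 0\<close> by (simp add: energy_def flux_def source_zero)
  finally have "energy y y1 (\<lambda>_. 0) 1 \<le> total_source (\<lambda>_. 0)"
    by (simp add: total_source_def source_zero set_lebesgue_integral_def)
  from K(2)[OF sol L2_plus_zero this] show False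
    using assms by (simp add: total_source_def source_zero set_lebesgue_integral_def flux_def)
qed

text \<open>The solutions with \<open>y 0 = \<alpha>\<close> and \<open>y n = 0\<close> have uniformly bounded initial slopes and energies;
  a subsequence converges, and Fatou's lemma puts the limit in \<open>L\<^sub>2\<close>.\<close>
lemma L2_solution_exists:
  assumes f: "L2_plus f"
  obtains y y1 where "solution y y1 f" "L2_plus y" "y 0 = \<alpha>"
proof -
  obtain u u1 where u: "solution u u1 f" "u 0 = \<alpha>" "u1 0 = 0" using cauchy_exists[OF f] by blast
  obtain v v1 where v: "solution v v1 (\<lambda>_. 0)" "v 0 = 0" "v1 0 = 1" using cauchy_exists[OF L2_plus_zero] by blast
  obtain K where K: "K > 0" "\<And>y y1 f. solution y y1 f \<Longrightarrow> L2_plus f \<Longrightarrow> energy y y1 f 1 \<le> total_source f \<Longrightarrow>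
    (cmod (y1 0))\<^sup>2 \<le> K * (2 * total_source f - flux y y1 0)"
    using initial_slope_bound by blast
  \<comment> \<open>\<open>Suc n\<close> keeps the endpoint at least \<open>1\<close>, where
    \<open>v\<close> does not vanish. As \<open>u1 0 = 0\<close> and \<open>v1 0 = 1\<close>,
    \<open>c n\<close> is the initial slope of \<open>Y n\<close>.\<close>
  define c where "c n = - u (real (Suc n)) / v (real (Suc n))" for n
  define Y where "Y n x = u x + c n * v x" for n x
  define Y1 where "Y1 n x = u1 x + c n * v1 x" for n x
  have comb: "solution (\<lambda>x. u x + a * v x) (\<lambda>x. u1 x + a * v1 x) f" for a
    using solution_add_cmult[OF u(1) v(1), of a] by simp
  have sol: "solution (Y n) (Y1 n) f" for n
    using comb by (simp add: Y_def[abs_def] Y1_def[abs_def])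
  have YN: "Y n (real (Suc n)) = 0" for n
    using solution_nonvanishing[OF v, of "real (Suc n)"] by (simp add: Y_def c_def)
  have EN: "energy (Y n) (Y1 n) f (real (Suc n)) \<le> total_source f" for n
    using YN[of n] source_primitive_le[OF f, of "real (Suc n)"] by (simp add: energy_def flux_def)
  define d where "d = cmod \<alpha> / cmod (p 0)"
  \<comment> \<open>The slope bound is quadratic in \<open>|c n|\<close> on one side and linear on
    the other, which fails beyond \<open>R\<close>. The summand \<open>1\<close> ensures
    \<open>|c n| \<ge> 1\<close>, so that the constant term is dominated by its product with
    \<open>|c n|\<close>.\<close>
  define R where "R = K * d + 1 + 2 * K * total_source f"
  have d: "0 \<le> d" by (simp add: d_def)
  have T: "0 \<le> total_source f" by (rule total_nonneg[OF f])
  have flux0: "- flux (Y n) (Y1 n) 0 \<le> d * cmod (c n)" for n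
    using abs_Re_le_cmod[of "c n * cnj \<alpha> / p 0"]
    by (simp add: flux_def Y_def Y1_def u v d_def norm_mult norm_divide mult.commute)
  have cR: "cmod (c n) \<le> R" for n
  proof (rule ccontr)
    assume "\<not> cmod (c n) \<le> R"
    then have R: "R < cmod (c n)" by simp
    have "energy (Y n) (Y1 n) f 1 \<le> total_source f"
      using energy_mono[OF sol[of n] f, of 1 "real (Suc n)"] EN[of n] by simp
    from K(2)[OF sol f this] have "(cmod (c n))\<^sup>2 \<le> K * (2 * total_source f - flux (Y n) (Y1 n) 0)"
      by (simp add: Y1_def u v)
    also have "\<dots> \<le> K * (2 * total_source f + d * cmod (c n))"
      using flux0[of n] K(1) by (intro mult_left_mono) auto
    finally have *: "(cmod (c n))\<^sup>2 \<le> K * (2 * total_source f) + K * d * cmod (c n)" by (simp add: algebra_simps)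
    have Kd: "0 \<le> K * d" "0 \<le> K * (2 * total_source f)" using K(1) d T by auto
    then have 1: "1 \<le> cmod (c n)" using R unfolding R_def by linarith
    have "K * (2 * total_source f) * 1 \<le> K * (2 * total_source f) * cmod (c n)"
      using 1 Kd(2) by (rule mult_left_mono)
    moreover have "R * cmod (c n) < cmod (c n) * cmod (c n)"
      using R 1 by (intro mult_strict_right_mono) auto
    moreover have "R * cmod (c n) = K * d * cmod (c n) + cmod (c n) + K * (2 * total_source f) * cmod (c n)"
      by (simp add: R_def algebra_simps)
    ultimately show False using * 1 unfolding power2_eq_square by linarith
  qed
  \<comment> \<open>Twice the largest possible rise of the energy: at most
    \<open>total_source f\<close> at the right end, at least \<open>- d * R\<close> at
    \<open>0\<close>.\<close>
  define B where "B = 2 * (total_source f + d * R)"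
  have bound: "(\<integral>\<^sup>+x\<in>{0..real (Suc n)}. ennreal (C * (cmod (Y n x))\<^sup>2) \<partial>lborel) \<le> ennreal B" for n
  proof -
    have "(\<integral>\<^sup>+x\<in>{0..real (Suc n)}. ennreal (C * (cmod (Y n x))\<^sup>2) \<partial>lborel)
        \<le> (\<integral>\<^sup>+x\<in>{0..real (Suc n)}. ennreal (rho q dp x * energy_density (Y n) (Y1 n) x) \<partial>lborel)"
    proof (rule nn_integral_mono_AE)
      show "AE x in lborel. ennreal (C * (cmod (Y n x))\<^sup>2) * indicator {0..real (Suc n)} x
          \<le> ennreal (rho q dp x * energy_density (Y n) (Y1 n) x) * indicator {0..real (Suc n)} x"
        using rho_ge
      proof eventually_elim
        case (elim x)
        show ?case
        proof (cases "x \<in> {0..real (Suc n)}")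
          case True
          then have "C * (cmod (Y n x))\<^sup>2 \<le> rho q dp x * energy_density (Y n) (Y1 n) x"
            using elim C_pos by (intro mult_mono) (auto simp: energy_density_def)
          then show ?thesis using True by (simp add: ennreal_leI)
        qed simp
      qed
    qed
    also have "\<dots> \<le> ennreal (2 * (energy (Y n) (Y1 n) f (real (Suc n)) - energy (Y n) (Y1 n) f 0))"
      by (rule energy_bound[OF sol f]) auto
    also have "\<dots> \<le> ennreal B"
    proof (rule ennreal_leI)
      have "d * cmod (c n) \<le> d * R" using cR d by (rule mult_left_mono)
      moreover have "2 * (e - e0) \<le> B" if "e \<le> total_source f" "- e0 \<le> a" "a \<le> d * R" for e e0 a
        using that by (simp add: B_def)
      ultimately show "2 * (energy (Y n) (Y1 n) f (real (Suc n)) - energy (Y n) (Y1 n) f 0) \<le> B"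
        using EN[of n] flux0[of n] unfolding energy_0 by blast
    qed
    finally show ?thesis .
  qed
  have "bounded (range c)" using cR by (auto simp: bounded_iff)
  then obtain l r where r: "strict_mono r" "(\<lambda>n. c (r n)) \<longlonglongrightarrow> l"
    using bounded_imp_convergent_subsequence[of c] by (auto simp: o_def)
  define y where "y x = u x + l * v x" for x
  define y1 where "y1 x = u1 x + l * v1 x" for x
  have soly: "solution y y1 f" using comb by (simp add: y_def[abs_def] y1_def[abs_def])
  define g where "g n x = ennreal (C * (cmod (Y (r n) x))\<^sup>2) * indicator {0..real (Suc (r n))} x" for n x
  have gm: "g n \<in> borel_measurable lborel" for n
  proof -
    have [measurable]: "(\<lambda>x. indicat_real {0..} x *\<^sub>R Y (r n) x) \<in> borel_measurable borel"
      using solution_measurable[OF sol[of "r n"]] by (simp add: set_borel_measurable_def)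
    have "(\<lambda>x. ennreal (C * (cmod (indicat_real {0..} x *\<^sub>R Y (r n) x))\<^sup>2) * indicator {0..real (Suc (r n))} x)
        \<in> borel_measurable borel" by measurable
    also have "(\<lambda>x. ennreal (C * (cmod (indicat_real {0..} x *\<^sub>R Y (r n) x))\<^sup>2) * indicator {0..real (Suc (r n))} x) = g n"
      by (auto simp: g_def indicator_def fun_eq_iff)
    finally show ?thesis by simp
  qed
  \<comment> \<open>Each fixed \<open>x \<ge> 0\<close> eventually lies inside the cut-off because
    \<open>r n \<ge> n\<close>.\<close>
  have lim: "liminf (\<lambda>n. g n x) = ennreal (C * (cmod (y x))\<^sup>2) * indicator {0..} x" for x
  proof (cases "0 \<le> x")
    case True
    have "(\<lambda>n. Y (r n) x) \<longlonglongrightarrow> y x"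
      unfolding Y_def y_def by (intro tendsto_intros r(2))
    then have "(\<lambda>n. ennreal (C * (cmod (Y (r n) x))\<^sup>2)) \<longlonglongrightarrow> ennreal (C * (cmod (y x))\<^sup>2)"
      by (intro tendsto_ennrealI tendsto_intros)
    moreover have "\<forall>\<^sub>F n in sequentially. ennreal (C * (cmod (Y (r n) x))\<^sup>2) = g n x"
    proof -
      obtain m :: nat where "x \<le> real m" using real_arch_simple by blast
      then have "x \<le> real (Suc (r n))" if "m \<le> n" for n
        using seq_suble[OF r(1), of n] that by linarith
      then show ?thesis
        unfolding eventually_sequentially g_def using True by (intro exI[of _ m]) auto
    qed
    ultimately have "(\<lambda>n. g n x) \<longlonglongrightarrow> ennreal (C * (cmod (y x))\<^sup>2)"
      by (rule Lim_transform_eventually)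
    then show ?thesis using True by (simp add: lim_imp_Liminf)
  next
    case False
    then have "g n x = 0" for n by (simp add: g_def)
    then show ?thesis using False by (simp add: Liminf_const)
  qed
  have "(\<integral>\<^sup>+x\<in>{0..}. ennreal (C * (cmod (y x))\<^sup>2) \<partial>lborel) \<le> liminf (\<lambda>n. \<integral>\<^sup>+x. g n x \<partial>lborel)"
    using nn_integral_liminf[of g lborel, OF gm] unfolding lim .
  also have "\<dots> \<le> limsup (\<lambda>n. \<integral>\<^sup>+x. g n x \<partial>lborel)" by (rule Liminf_le_Limsup) simp
  also have "\<dots> \<le> ennreal B"
    using bound by (intro Limsup_bounded) (simp add: g_def)
  finally have fin: "(\<integral>\<^sup>+x\<in>{0..}. ennreal (C * (cmod (y x))\<^sup>2) \<partial>lborel) < \<infinity>"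
    by (simp add: less_top order_le_less_trans)
  have "L2_plus y"
    unfolding L2_plus_def
  proof
    show ym: "set_borel_measurable lborel {0..} y" by (rule solution_measurable[OF soly])
    have [measurable]: "(\<lambda>x. indicat_real {0..} x *\<^sub>R y x) \<in> borel_measurable borel"
      using ym by (simp add: set_borel_measurable_def)
    have "(\<lambda>x. C * (cmod (indicat_real {0..} x *\<^sub>R y x))\<^sup>2) \<in> borel_measurable borel" by measurable
    also have "(\<lambda>x. C * (cmod (indicat_real {0..} x *\<^sub>R y x))\<^sup>2) = (\<lambda>x. indicat_real {0..} x * (C * (cmod (y x))\<^sup>2))"
      by (auto simp: indicator_def fun_eq_iff)
    finally have m: "(\<lambda>x. indicat_real {0..} x * (C * (cmod (y x))\<^sup>2)) \<in> borel_measurable borel" .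
    have "(\<integral>\<^sup>+x\<in>{0..}. ennreal ((cmod (y x))\<^sup>2) \<partial>lborel)
        = (\<integral>\<^sup>+x. ennreal (1 / C) * (ennreal (C * (cmod (y x))\<^sup>2) * indicator {0..} x) \<partial>lborel)"
      using C_pos by (intro nn_integral_cong) (auto simp: indicator_def simp flip: ennreal_mult)
    also have "\<dots> = ennreal (1 / C) * (\<integral>\<^sup>+x\<in>{0..}. ennreal (C * (cmod (y x))\<^sup>2) \<partial>lborel)"
    proof (rule nn_integral_cmult)
      have "(\<lambda>x. ennreal (indicat_real {0..} x * (C * (cmod (y x))\<^sup>2))) \<in> borel_measurable lborel"
        using m by simp
      also have "(\<lambda>x. ennreal (indicat_real {0..} x * (C * (cmod (y x))\<^sup>2)))
          = (\<lambda>x. ennreal (C * (cmod (y x))\<^sup>2) * indicator {0..} x)"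
        by (auto simp: indicator_def)
      finally show "(\<lambda>x. ennreal (C * (cmod (y x))\<^sup>2) * indicator {0..} x) \<in> borel_measurable lborel" .
    qed
    also have "\<dots> < \<infinity>" using fin by (simp add: ennreal_mult_less_top)
    finally show "(\<integral>\<^sup>+x\<in>{0..}. ennreal ((cmod (y x))\<^sup>2) \<partial>lborel) < \<infinity>" .
  qed
  moreover have "y 0 = \<alpha>" by (simp add: y_def u v)
  ultimately show thesis using soly that by blast
qed

section \<open>The resolvent bound\<close>

lemma weighted_norm_eq_total:
  assumes f: "L2_plus f"
  shows "(\<integral>\<^sup>+x\<in>{0..}. ennreal ((cmod (f x))\<^sup>2 / cmod (q x)) \<partial>lborel) = ennreal (2 * C * total_source f)"
proof -
  have i: "integrable lborel (\<lambda>x. indicat_real {0..} x *\<^sub>R ((cmod (f x))\<^sup>2 / cmod (q x)))"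
    using weighted_norm_integrable[OF f] by (simp only: set_integrable_def)
  have "(\<integral>\<^sup>+x\<in>{0..}. ennreal ((cmod (f x))\<^sup>2 / cmod (q x)) \<partial>lborel)
      = (\<integral>\<^sup>+x. ennreal (indicat_real {0..} x *\<^sub>R ((cmod (f x))\<^sup>2 / cmod (q x))) \<partial>lborel)"
    by (intro nn_integral_cong) (simp add: indicator_def)
  also have "\<dots> = ennreal (LINT x:{0..}|lborel. (cmod (f x))\<^sup>2 / cmod (q x))"
    unfolding set_lebesgue_integral_def by (rule nn_integral_eq_integral[OF i]) simp
  also have "(LINT x:{0..}|lborel. (cmod (f x))\<^sup>2 / cmod (q x)) = 2 * C * total_source f"
    unfolding total_source_def source_eq[abs_def] using C_pos by (subst set_integral_mult_right) simp
  finally show ?thesis .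
qed

text \<open>In the energy bound on \<open>[0, n]\<close> the value at \<open>n\<close> is replaced
  by \<open>total_source f\<close>, so the bound no longer depends on \<open>n\<close>.\<close>

lemma L2_solution_bound:
  assumes sol: "solution y y1 f" and f: "L2_plus f" and y: "L2_plus y"
  shows "(\<integral>\<^sup>+x\<in>{0..}. ennreal (rho q dp x * energy_density y y1 x) \<partial>lborel)
    \<le> ennreal (2 * (total_source f - flux y y1 0))"
proof (rule nn_integral_atLeast_le)
  fix n :: nat
  have "(\<integral>\<^sup>+x\<in>{0..real n}. ennreal (rho q dp x * energy_density y y1 x) \<partial>lborel)
      \<le> ennreal (2 * (energy y y1 f (real n) - energy y y1 f 0))"
    by (rule energy_bound[OF sol f]) auto
  also have "\<dots> \<le> ennreal (2 * (total_source f - flux y y1 0))"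
    using energy_le_total[OF sol f y, of "real n"] by (intro ennreal_leI) (simp add: energy_0)
  finally show "(\<integral>\<^sup>+x\<in>{0..real n}. ennreal (rho q dp x * energy_density y y1 x) \<partial>lborel)
      \<le> ennreal (2 * (total_source f - flux y y1 0))" .
qed

text \<open>The integrands are the two summands of \<open>rho * energy_density\<close>, each
  nonnegative wherever \<open>C \<le> rho\<close>.\<close>

lemma weighted_integrals_le:
  shows "(\<integral>\<^sup>+x\<in>{0..}. ennreal (rho q dp x * (cmod (y x))\<^sup>2) \<partial>lborel)
      \<le> (\<integral>\<^sup>+x\<in>{0..}. ennreal (rho q dp x * energy_density y y1 x) \<partial>lborel)"
    and "(\<integral>\<^sup>+x\<in>{0..}. ennreal (rho q dp x / cmod (q x) * (cmod (y1 x))\<^sup>2) \<partial>lborel)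
      \<le> (\<integral>\<^sup>+x\<in>{0..}. ennreal (rho q dp x * energy_density y y1 x) \<partial>lborel)"
proof -
  have "AE x in lborel. x \<ge> 0 \<longrightarrow>
      rho q dp x * (cmod (y x))\<^sup>2 \<le> rho q dp x * energy_density y y1 x \<and>
      rho q dp x / cmod (q x) * (cmod (y1 x))\<^sup>2 \<le> rho q dp x * energy_density y y1 x"
    using rho_ge
  proof eventually_elim
    case (elim x)
    have "rho q dp x * (cmod (y x))\<^sup>2 \<le> rho q dp x * energy_density y y1 x"
      "rho q dp x * ((cmod (y1 x))\<^sup>2 / cmod (q x)) \<le> rho q dp x * energy_density y y1 x" if "x \<ge> 0"
      by (rule mult_left_mono; use elim that C_pos in \<open>simp add: energy_density_def\<close>)+
    then show ?case by simp
  qed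
  then have *: "AE x in lborel. ennreal (rho q dp x * (cmod (y x))\<^sup>2) * indicator {0..} x
        \<le> ennreal (rho q dp x * energy_density y y1 x) * indicator {0..} x \<and>
      ennreal (rho q dp x / cmod (q x) * (cmod (y1 x))\<^sup>2) * indicator {0..} x
        \<le> ennreal (rho q dp x * energy_density y y1 x) * indicator {0..} x"
    by eventually_elim (simp add: indicator_def ennreal_leI)
  show "(\<integral>\<^sup>+x\<in>{0..}. ennreal (rho q dp x * (cmod (y x))\<^sup>2) \<partial>lborel)
      \<le> (\<integral>\<^sup>+x\<in>{0..}. ennreal (rho q dp x * energy_density y y1 x) \<partial>lborel)"
    using * by (intro nn_integral_mono_AE) auto
  show "(\<integral>\<^sup>+x\<in>{0..}. ennreal (rho q dp x / cmod (q x) * (cmod (y1 x))\<^sup>2) \<partial>lborel)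
      \<le> (\<integral>\<^sup>+x\<in>{0..}. ennreal (rho q dp x * energy_density y y1 x) \<partial>lborel)"
    using * by (intro nn_integral_mono_AE) auto
qed

text \<open>Subtracting \<open>y 0\<close> times a square-integrable homogeneous solution \<open>e\<close> with \<open>e 0 = 1\<close> leaves a
  solution \<open>w\<close> with \<open>w 0 = 0\<close>, whose flux vanishes at \<open>0\<close>; hence \<open>w' 0\<close> is controlled by \<open>f\<close>. As \<open>0\<close> is
  not an eigenvalue, \<open>e\<close> violates the boundary condition, so \<open>w' 0\<close> determines \<open>y 0\<close> and \<open>y' 0\<close>.\<close>
theorem resolvent_bound:
  assumes noneigen: "\<not> (\<exists>y y1. solves_LU q a0 a1 y y1 (\<lambda>_. 0) \<and> (\<exists>x\<ge>0. y x \<noteq> 0))"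
  shows "\<exists>K>0. \<forall>f. L2_plus f \<longrightarrow> (\<exists>y y1. solves_LU q a0 a1 y y1 f) \<and>
    (\<forall>y y1. solves_LU q a0 a1 y y1 f \<longrightarrow>
      (\<integral>\<^sup>+x\<in>{0..}. ennreal (rho q dp x * energy_density y y1 x) \<partial>lborel)
        \<le> ennreal K * (\<integral>\<^sup>+x\<in>{0..}. ennreal ((cmod (f x))\<^sup>2 / cmod (q x)) \<partial>lborel))"
proof -
  obtain e e1 where e: "solution e e1 (\<lambda>_. 0)" "L2_plus e" "e 0 = 1"
    using L2_solution_exists[OF L2_plus_zero] by blast
  define U where "U = a0 + a1 * e1 0"
  have U: "U \<noteq> 0"
  proof
    assume "U = 0"
    then have "solves_LU q a0 a1 e e1 (\<lambda>_. 0)"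
      using e by (simp add: solves_LU_iff U_def L2_plus_zero)
    then show False using noneigen e(3) by force
  qed
  obtain K0 where K0: "K0 > 0" "\<And>y y1 f. solution y y1 f \<Longrightarrow> L2_plus f \<Longrightarrow> energy y y1 f 1 \<le> total_source f \<Longrightarrow>
    (cmod (y1 0))\<^sup>2 \<le> K0 * (2 * total_source f - flux y y1 0)"
    using initial_slope_bound by blast
  have comb: "solution (\<lambda>x. y x + c * e x) (\<lambda>x. y1 x + c * e1 x) f \<and> L2_plus (\<lambda>x. y x + c * e x)"
    if "solution y y1 f" "L2_plus y" for y y1 f c
    using solution_add_cmult[OF that(1) e(1), of c] L2_plus_add_cmult[OF that(2) e(2)] by simp
  \<comment> \<open>Coefficients expressing the initial data by \<open>w1 0\<close>: below,
    \<open>y 0 = \<beta> * w1 0\<close> and \<open>y1 0 = \<gamma> * w1 0\<close>. The flux at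
    \<open>0\<close> is then at most \<open>D * |w1 0|^2\<close> in modulus.\<close>
  define \<beta> \<gamma> where "\<beta> = - a1 / U" and "\<gamma> = 1 + \<beta> * e1 0"
  define D where "D = cmod \<gamma> * cmod \<beta> / cmod (p 0)"
  have D: "0 \<le> D" by (simp add: D_def)
  \<comment> \<open>The division by \<open>C\<close> arises because the weighted norm of
    \<open>f\<close> equals \<open>2 * C * total_source f\<close>.\<close>
  define K where "K = (1 + 2 * D * K0) / C"
  have K: "K > 0" using D K0(1) C_pos by (auto simp: K_def intro!: divide_pos_pos add_pos_nonneg)
  show ?thesis
  proof (intro exI[of _ K] conjI allI impI K)
    fix f assume f: "L2_plus f"
    obtain z z1 where z: "solution z z1 f" "L2_plus z" "z 0 = 0"
      using L2_solution_exists[OF f] by blast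
    \<comment> \<open>As \<open>z 0 = 0\<close> and \<open>e 0 = 1\<close>, the boundary form of
      \<open>z + c * e\<close> is \<open>a1 * z1 0 + c * U\<close>, and this \<open>c\<close> is its
      zero.\<close>
    define c where "c = \<beta> * z1 0"
    have "a0 * (z 0 + c * e 0) + a1 * (z1 0 + c * e1 0) = a1 * z1 0 + c * U"
      by (simp add: z(3) e(3) U_def algebra_simps)
    also have "\<dots> = 0" using U by (simp add: c_def \<beta>_def)
    finally show "\<exists>y y1. solves_LU q a0 a1 y y1 f"
      using comb[OF z(1,2), of c] f unfolding solves_LU_iff by blast
  next
    fix f y y1 assume f: "L2_plus f" and LU: "solves_LU q a0 a1 y y1 f"
    then have y: "solution y y1 f" "L2_plus y" "a0 * y 0 + a1 * y1 0 = 0"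
      by (simp_all add: solves_LU_iff)
    define w w1 where "w x = y x + (- y 0) * e x" and "w1 x = y1 x + (- y 0) * e1 x" for x
    have w: "solution w w1 f" "L2_plus w" "w 0 = 0"
      using comb[OF y(1,2), of "- y 0"] e(3) by (simp_all add: w_def[abs_def] w1_def[abs_def])
    have "(cmod (w1 0))\<^sup>2 \<le> K0 * (2 * total_source f - flux w w1 0)"
      using energy_le_total[OF w(1) f w(2), of 1] by (intro K0(2)[OF w(1) f]) simp
    then have w1: "(cmod (w1 0))\<^sup>2 \<le> K0 * (2 * total_source f)" by (simp add: flux_def w(3))
    have "y 0 * U = - a1 * w1 0"
      using y(3) by (simp add: U_def w1_def algebra_simps)
    then have y0: "y 0 = \<beta> * w1 0"
      using U by (simp add: \<beta>_def field_simps)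
    have "y1 0 = w1 0 + y 0 * e1 0" by (simp add: w1_def)
    also have "\<dots> = \<gamma> * w1 0" unfolding y0 by (simp add: \<gamma>_def algebra_simps)
    finally have y10: "y1 0 = \<gamma> * w1 0" .
    have "- flux y y1 0 \<le> cmod (y1 0 * cnj (y 0) / p 0)"
      using abs_Re_le_cmod[of "y1 0 * cnj (y 0) / p 0"] by (simp add: flux_def)
    also have "\<dots> = D * (cmod (w1 0))\<^sup>2"
      by (simp add: y0 y10 D_def norm_mult norm_divide power2_eq_square)
    also have "\<dots> \<le> D * (K0 * (2 * total_source f))" using w1 D by (rule mult_left_mono)
    finally have "2 * (total_source f - flux y y1 0) \<le> 2 * (1 + 2 * D * K0) * total_source f"
      by (simp add: algebra_simps)
    also have "\<dots> = K * (2 * C * total_source f)" using C_pos by (simp add: K_def)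
    finally have "2 * (total_source f - flux y y1 0) \<le> K * (2 * C * total_source f)" .
    then have "ennreal (2 * (total_source f - flux y y1 0)) \<le> ennreal K * ennreal (2 * C * total_source f)"
      using K C_pos total_nonneg[OF f] by (simp add: ennreal_leI flip: ennreal_mult)
    then show "(\<integral>\<^sup>+x\<in>{0..}. ennreal (rho q dp x * energy_density y y1 x) \<partial>lborel)
        \<le> ennreal K * (\<integral>\<^sup>+x\<in>{0..}. ennreal ((cmod (f x))\<^sup>2 / cmod (q x)) \<partial>lborel)"
      unfolding weighted_norm_eq_total[OF f]
      using L2_solution_bound[OF y(1) f y(2)] by (rule order_trans[rotated])
  qed
qed

end

theorem theorem4:
  fixes q dp :: "real \<Rightarrow> complex" and a0 a1 :: complex
  assumes "cmod a0 + cmod a1 \<noteq> 0"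
    and "condition_A q dp"
    and "\<not> (\<exists>y y1. solves_LU q a0 a1 y y1 (\<lambda>_. 0) \<and> (\<exists>x\<ge>0. y x \<noteq> 0))"
  shows "\<exists>K>0. \<forall>f. L2_plus f \<longrightarrow>
           (\<exists>y y1. solves_LU q a0 a1 y y1 f) \<and>
           (\<forall>y y1. solves_LU q a0 a1 y y1 f \<longrightarrow>
              (\<integral>\<^sup>+x\<in>{0..}. ennreal (rho q dp x * (cmod (y x))\<^sup>2) \<partial>lborel)
                \<le> ennreal K * (\<integral>\<^sup>+x\<in>{0..}. ennreal ((cmod (f x))\<^sup>2 / cmod (q x)) \<partial>lborel) \<and>
              (\<integral>\<^sup>+x\<in>{0..}. ennreal (rho q dp x / cmod (q x) * (cmod (y1 x))\<^sup>2) \<partial>lborel)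
                \<le> ennreal K * (\<integral>\<^sup>+x\<in>{0..}. ennreal ((cmod (f x))\<^sup>2 / cmod (q x)) \<partial>lborel))"
proof -
  obtain C where "condition_A_potential q dp C"
    using assms(2) sector_avoids_nonpos_Reals
    unfolding condition_A_def condition_A_potential_def by blast
  then interpret condition_A_potential q dp C .
  \<comment> \<open>Both weighted integrals are dominated by the one in
    \<open>resolvent_bound\<close>, so the same \<open>K\<close> serves for both.\<close>
  from resolvent_bound[OF assms(3)] show ?thesis
    using weighted_integrals_le by (meson order_trans)
qed

end
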